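(* There exist universal constants $F,A_0,C>0$ such that the following holds. Consider the data model and the estimator $\hat\beta$ (a solution of the linear program with regularisation parameter $\lambda$) described in the context. Assume that $\mathbb{E}[X]=0$, that $\|X\|_{\psi_2}\le R_X$ for some $R_X>0$, that the noise $\epsilon$ is sub-Gaussian with parameter $\sigma$, that $\Sigma$ satisfies $Re(s,\Phi_\Sigma)$ for some constant $\Phi_\Sigma>0$, and that $\|\beta^*\|_0\le s$. Assume that there exists $\rho\in(0,1)$ such that for all $(g,h)\in[L]^2$, $\rho n_{\mathcal L}\le h_g$ and $\rho^2n_{\mathcal L}\le n_{g,h}$. For $A>0$, let $$\lambda=A\sqrt{\max\left\{\frac{R_X^2(\sigma+R_X\|\beta^*\|_2)^2\log(p)}{\rho n_{\mathcal L}},\frac{R_X^4\|\beta^*\|_2^2\log(p)}{\rho^2n_{\mathcal L}+N}\right\}}.$$ Additionally assume that $$\rho n_{\mathcal L}\ge FA^2\max\left\{1,\frac{(\sigma+R_X\|\beta^*\|_2)^2}{R_X^2\|\beta^*\|_2^2}\right\}\log(p),$$ $$\rho^2n_{\mathcal L}+N\ge F\max\left\{\frac{R_X^4s^2}{\Phi_\Sigma^2},\frac{R_X^2s}{\Phi_\Sigma},A^2,\frac{A^2R_X^2\|\beta^*\|_2^2}{(\sigma+R_X\|\beta^*\|_2)^2}\right\}\log(p).$$ Then, provided $A\ge A_0$, with probability at least $1-\frac6p$, $$\|\hat\beta-\beta^*\|_2^2\le C\,\frac{A^2s}{\Phi_\Sigma^2}\left(\frac{R_X^2(\sigma+R_X\|\beta^*\|_2)^2\log(p)}{\rho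 n_{\mathcal L}}+\frac{R_X^4\|\beta^*\|_2^2\log(p)}{\rho^2n_{\mathcal L}+N}\right).$$
   Context: Data model: $(X,Y)\in\mathbb{R}^p\times\mathbb{R}$ with $X\sim P_X$, $\Sigma=\mathbb{E}[XX^T]$, and $Y=X^T\beta^*+\epsilon$, where $\beta^*\in\mathbb{R}^p$, $\mathbb{E}[\epsilon|X]=0$, $\mathrm{Var}[\epsilon|X]=\sigma^2$. There are $K$ missingness patterns with observed sets $O_k\subseteq[p]$, $\cup_kO_k=[p]$. The labelled data consist, independently over $k\in[K]$, of $n_k$ i.i.d. copies of $(X_{O_k},Y)$, $n_{\mathcal L}=\sum_kn_k$; $\mathcal I_{\mathcal L}$ is the index set of labelled observations, and $\Xi(i)\in[K]$ is the pattern of observation $i$. There are also $N\ge0$ unlabelled i.i.d. copies of $X$, independent of the labelled data, with index set $\mathcal I_{\mathcal U}$. The modalities $L_1,\dots,L_L$ form the partition of $[p]$ with the smallest number $L$ of parts such that each $O_k$ is a union of parts; $\xi(j)=g$ if $j\in L_g$; $h_g=\sum_kn_k\mathbb{1}_{\{L_g\subseteq O_k\}}$ and $n_{g,h}=\sum_kn_k\mathbb{1}_{\{L_g\cup L_h\subseteq O_k\}}$. Estimator: it is assumed that $n_{g,h}+N>0$ for all $g,h$. For $i,j\in[p]$, $$\hat\gamma_j=\frac{1}{h_{\xi(j)}}\sum_{i\in\mathcal I_{\mathcal L}}(X_i)_jY_i\mathbb{1}_{\{j\in O_{\Xi(i)}\}},\quad\hat\Sigma_{ij}=\frac{1}{n_{\xi(i),\xi(j)}+N}\left(\sum_{k\in\mathcal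 I_{\mathcal U}}(X_k)_i(X_k)_j+\sum_{k\in\mathcal I_{\mathcal L}}(X_k)_i(X_k)_j\mathbb{1}_{\{\{i,j\}\subseteq O_{\Xi(k)}\}}\right),$$ and $\hat\beta\in\arg\min_{\beta\in\mathbb{R}^p}\{\|\beta\|_1:\|\hat\Sigma\beta-\hat\gamma\|_\infty\le\lambda\}$. Definitions: $\|Z\|_{\psi_2}=\inf\{c>0:\mathbb{E}e^{Z^2/c^2}\le2\}$ for scalar $Z$ and $\|X\|_{\psi_2}=\sup_{\|u\|_2=1}\|u^TX\|_{\psi_2}$ for vectors. The (mean-zero) noise $\epsilon$ is sub-Gaussian with parameter $\sigma$ if $\mathbb{E}e^{t\epsilon}\le e^{t^2\sigma^2/2}$ for all $t\in\mathbb{R}$. $\|x\|_0$ is the number of nonzero entries of $x$. For $A\in\mathbb{R}^{p\times p}$ and $s\in[0,p]$, $$\phi^2(A,s)=\inf_{S\subset[p],|S|\le s}\ \inf_{\delta\ne0:\|\delta_{S^c}\|_1\le\|\delta_S\|_1}\frac{\delta^TA\delta}{\|\delta_{M(\delta)}\|_2^2},\quad M(\delta)=S\cup\{i\in S^c:|\delta_i|\ge|\delta_{S^c}|_{(\min\{s,|S^c|\})}\},$$ where $|\delta_{S^c}|_{(j)}$ is the $j$th largest absolute value among the entries of $\delta_{S^c}$. $A$ satisfies $Re(s,\Phi)$ if $\phi^2(A,s)\ge\Phi$. *)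

theory Defs
  imports "HOL-Probability.Probability" "HOL-Library.Disjoint_Sets"
begin

section \<open>Vectors and matrices of variable dimension\<close>

text \<open>
  The constants in the theorem must not depend on the dimension, so the dimension p is a natural
  number, not a type. A vector is a function on the naturals and a matrix a function of two
  naturals; only the entries with indices in \<open>{..<p}\<close> matter. The Euclidean norm of the
  entries indexed by S is the library's \<open>L2_set x S\<close>.
\<close>

abbreviation RN :: "nat \<Rightarrow> (nat \<Rightarrow> real) measure" where
  "RN p \<equiv> PiM {..<p} (\<lambda>_. borel)"

definition inner_p :: "nat \<Rightarrow> (nat \<Rightarrow> real) \<Rightarrow> (nat \<Rightarrow> real) \<Rightarrow> real" where
  "inner_p p x y = (\<Sum>j<p. x j * y j)"

definition mat_vec :: "nat \<Rightarrow> (nat \<Rightarrow> nat \<Rightarrow> real) \<Rightarrow> (nat \<Rightarrow> real) \<Rightarrow> nat \<Rightarrow> real" where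
  "mat_vec p A x = (\<lambda>i. \<Sum>j<p. A i j * x j)"

definition l1_norm_on :: "nat set \<Rightarrow> (nat \<Rightarrow> real) \<Rightarrow> real" where
  "l1_norm_on S x = (\<Sum>j\<in>S. \<bar>x j\<bar>)"

definition l0_norm :: "nat \<Rightarrow> (nat \<Rightarrow> real) \<Rightarrow> nat" where
  "l0_norm p x = card {j. j < p \<and> x j \<noteq> 0}"

definition linf_norm :: "nat \<Rightarrow> (nat \<Rightarrow> real) \<Rightarrow> real" where
  "linf_norm p x = Max ((\<lambda>j. \<bar>x j\<bar>) ` {..<p})"


section \<open>Sub-Gaussian random variables\<close>

text \<open>
  Expectations of nonnegative functions are taken in \<open>[0, \<infinity>]\<close>, since the Bochner integral of a
  function that is not integrable is 0. The infimum of the empty set is \<open>\<infinity>\<close>.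
\<close>

definition psi2_norm :: "'a measure \<Rightarrow> ('a \<Rightarrow> real) \<Rightarrow> ennreal" where
  "psi2_norm M Z =
     Inf {ennreal c | c. c > 0 \<and> (\<integral>\<^sup>+ w. ennreal (exp ((Z w)\<^sup>2 / c\<^sup>2)) \<partial>M) \<le> 2}"

definition psi2_norm_vec :: "nat \<Rightarrow> 'a measure \<Rightarrow> ('a \<Rightarrow> nat \<Rightarrow> real) \<Rightarrow> ennreal" where
  "psi2_norm_vec p M X =
     (SUP u \<in> {u. L2_set u {..<p} = 1}. psi2_norm M (\<lambda>w. inner_p p u (X w)))"

definition sub_gaussian :: "'a measure \<Rightarrow> ('a \<Rightarrow> real) \<Rightarrow> real \<Rightarrow> bool" where
  "sub_gaussian M Z \<sigma> \<longleftrightarrow>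
     (\<forall>t. (\<integral>\<^sup>+ w. ennreal (exp (t * Z w)) \<partial>M) \<le> ennreal (exp (t\<^sup>2 * \<sigma>\<^sup>2 / 2)))"


section \<open>The restricted eigenvalue condition\<close>

definition kth_largest_abs :: "nat set \<Rightarrow> (nat \<Rightarrow> real) \<Rightarrow> nat \<Rightarrow> real" where
  "kth_largest_abs T d k = rev (sort (map (\<lambda>i. \<bar>d i\<bar>) (sorted_list_of_set T))) ! (k - 1)"

text \<open>
  The order statistic has index 0 only if s = 0 or \<open>T = {}\<close>. In the first case the inner
  infimum in \<open>re_phi_sq\<close> is over the empty set, in the second \<open>re_support\<close> is S.
\<close>

definition re_support :: "nat \<Rightarrow> nat \<Rightarrow> nat set \<Rightarrow> (nat \<Rightarrow> real) \<Rightarrow> nat set" where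
  "re_support p s S d =
     (let T = {..<p} - S
      in S \<union> {i \<in> T. \<bar>d i\<bar> \<ge> kth_largest_abs T d (min s (card T))})"

definition re_phi_sq :: "nat \<Rightarrow> (nat \<Rightarrow> nat \<Rightarrow> real) \<Rightarrow> nat \<Rightarrow> ereal" where
  "re_phi_sq p A s =
     (INF S \<in> {S. S \<subseteq> {..<p} \<and> card S \<le> s}.
      INF d \<in> {d. (\<exists>i<p. d i \<noteq> 0) \<and> l1_norm_on ({..<p} - S) d \<le> l1_norm_on S d}.
        ereal (inner_p p d (mat_vec p A d) / (L2_set d (re_support p s S d))\<^sup>2))"

definition Re_cond :: "nat \<Rightarrow> (nat \<Rightarrow> nat \<Rightarrow> real) \<Rightarrow> nat \<Rightarrow> real \<Rightarrow> bool" where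
  "Re_cond p A s \<Phi> \<longleftrightarrow> re_phi_sq p A s \<ge> ereal \<Phi>"


section \<open>The population\<close>

text \<open>
  P is the joint law of (X, Y), so X and Y are the two projections and the noise is the residual
  \<open>Y - X\<^sup>T \<beta>\<close>. Working with laws keeps the constants of the theorem independent of the
  underlying probability space, whose type could not be quantified inside the formula.
\<close>

definition noise :: "nat \<Rightarrow> (nat \<Rightarrow> real) \<Rightarrow> (nat \<Rightarrow> real) \<times> real \<Rightarrow> real" where
  "noise p \<beta> = (\<lambda>(x, y). y - inner_p p x \<beta>)"

definition sigma_X :: "nat \<Rightarrow> ((nat \<Rightarrow> real) \<times> real) measure \<Rightarrow> ((nat \<Rightarrow> real) \<times> real) measure" where
  "sigma_X p P = vimage_algebra (space P) fst (RN p)"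

definition linear_model ::
  "nat \<Rightarrow> ((nat \<Rightarrow> real) \<times> real) measure \<Rightarrow> (nat \<Rightarrow> real) \<Rightarrow> real \<Rightarrow> bool" where
  "linear_model p P \<beta> \<sigma> \<longleftrightarrow>
     prob_space P \<and> sets P = sets (RN p \<Otimes>\<^sub>M borel) \<and>
     (\<forall>j<p. integrable P (\<lambda>w. (fst w j)\<^sup>2)) \<and>
     integrable P (\<lambda>w. (noise p \<beta> w)\<^sup>2) \<and>
     \<sigma> \<ge> 0 \<and>
     (AE w in P. real_cond_exp P (sigma_X p P) (noise p \<beta>) w = 0) \<and>
     (AE w in P. real_cond_exp P (sigma_X p P)
        (\<lambda>v. (noise p \<beta> v - real_cond_exp P (sigma_X p P) (noise p \<beta>) v)\<^sup>2) w = \<sigma>\<^sup>2)"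

definition mean_X :: "((nat \<Rightarrow> real) \<times> real) measure \<Rightarrow> nat \<Rightarrow> real" where
  "mean_X P j = (\<integral>w. fst w j \<partial>P)"

definition Sigma_X :: "((nat \<Rightarrow> real) \<times> real) measure \<Rightarrow> nat \<Rightarrow> nat \<Rightarrow> real" where
  "Sigma_X P i j = (\<integral>w. fst w i * fst w j \<partial>P)"


section \<open>Missingness patterns and modalities\<close>

text \<open>
  The patterns are numbered \<open>k < K\<close>, \<open>Ob k\<close> is the observed set of pattern k, and
  \<open>n k\<close> is the number of labelled observations with pattern k. A modality is named by the set
  of its coordinates instead of by a number.
\<close>

definition union_of_parts :: "nat \<Rightarrow> nat \<Rightarrow> (nat \<Rightarrow> nat set) \<Rightarrow> nat set set \<Rightarrow> bool" where
  "union_of_parts p K Ob \<L> \<longleftrightarrow>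
     partition_on {..<p} \<L> \<and> (\<forall>k<K. \<exists>\<Q>\<subseteq>\<L>. Ob k = \<Union>\<Q>)"

definition modalities :: "nat \<Rightarrow> nat \<Rightarrow> (nat \<Rightarrow> nat set) \<Rightarrow> nat set set \<Rightarrow> bool" where
  "modalities p K Ob \<L> \<longleftrightarrow> is_arg_min card (union_of_parts p K Ob) \<L>"

definition modality_of :: "nat set set \<Rightarrow> nat \<Rightarrow> nat set" where
  "modality_of \<L> j = (THE G. G \<in> \<L> \<and> j \<in> G)"

definition n_lab :: "nat \<Rightarrow> (nat \<Rightarrow> nat) \<Rightarrow> nat" where
  "n_lab K n = (\<Sum>k<K. n k)"

definition h_count :: "nat \<Rightarrow> (nat \<Rightarrow> nat set) \<Rightarrow> (nat \<Rightarrow> nat) \<Rightarrow> nat set \<Rightarrow> nat" where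
  "h_count K Ob n G = (\<Sum>k<K. n k * of_bool (G \<subseteq> Ob k))"

definition pair_count ::
  "nat \<Rightarrow> (nat \<Rightarrow> nat set) \<Rightarrow> (nat \<Rightarrow> nat) \<Rightarrow> nat set \<Rightarrow> nat set \<Rightarrow> nat" where
  "pair_count K Ob n G H = (\<Sum>k<K. n k * of_bool (G \<union> H \<subseteq> Ob k))"


section \<open>The data\<close>

text \<open>
  The index (k, l) stands for the l-th labelled observation with pattern k, so the pattern of the
  observation i is \<open>fst i\<close>. A labelled observation contains only the observed coordinates.
\<close>

type_synonym data = "(nat \<times> nat \<Rightarrow> (nat \<Rightarrow> real) \<times> real) \<times> (nat \<Rightarrow> nat \<Rightarrow> real)"

definition lab_idx :: "nat \<Rightarrow> (nat \<Rightarrow> nat) \<Rightarrow> (nat \<times> nat) set" where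
  "lab_idx K n = (SIGMA k:{..<K}. {..<n k})"

definition lab_law ::
  "((nat \<Rightarrow> real) \<times> real) measure \<Rightarrow> nat set \<Rightarrow> ((nat \<Rightarrow> real) \<times> real) measure" where
  "lab_law P S = distr P (PiM S (\<lambda>_. borel) \<Otimes>\<^sub>M borel) (\<lambda>(x, y). (restrict x S, y))"

definition data_law ::
  "nat \<Rightarrow> nat \<Rightarrow> (nat \<Rightarrow> nat set) \<Rightarrow> (nat \<Rightarrow> nat) \<Rightarrow> nat \<Rightarrow>
     ((nat \<Rightarrow> real) \<times> real) measure \<Rightarrow> data measure" where
  "data_law p K Ob n N P =
     PiM (lab_idx K n) (\<lambda>i. lab_law P (Ob (fst i))) \<Otimes>\<^sub>M PiM {..<N} (\<lambda>_. distr P (RN p) fst)"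


section \<open>The estimator\<close>

definition gamma_hat ::
  "nat \<Rightarrow> (nat \<Rightarrow> nat set) \<Rightarrow> (nat \<Rightarrow> nat) \<Rightarrow> nat set set \<Rightarrow> data \<Rightarrow> nat \<Rightarrow> real" where
  "gamma_hat K Ob n \<L> = (\<lambda>(lab, unl) j.
     1 / real (h_count K Ob n (modality_of \<L> j)) *
     (\<Sum>i\<in>lab_idx K n. fst (lab i) j * snd (lab i) * of_bool (j \<in> Ob (fst i))))"

definition Sigma_hat ::
  "nat \<Rightarrow> (nat \<Rightarrow> nat set) \<Rightarrow> (nat \<Rightarrow> nat) \<Rightarrow> nat \<Rightarrow> nat set set \<Rightarrow> data \<Rightarrow> nat \<Rightarrow> nat \<Rightarrow> real" where
  "Sigma_hat K Ob n N \<L> = (\<lambda>(lab, unl) i j.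
     1 / real (pair_count K Ob n (modality_of \<L> i) (modality_of \<L> j) + N) *
     ((\<Sum>k<N. unl k i * unl k j) +
      (\<Sum>k\<in>lab_idx K n. fst (lab k) i * fst (lab k) j * of_bool ({i, j} \<subseteq> Ob (fst k)))))"

definition is_estimate ::
  "nat \<Rightarrow> nat \<Rightarrow> (nat \<Rightarrow> nat set) \<Rightarrow> (nat \<Rightarrow> nat) \<Rightarrow> nat \<Rightarrow> nat set set \<Rightarrow> real \<Rightarrow>
     data \<Rightarrow> (nat \<Rightarrow> real) \<Rightarrow> bool" where
  "is_estimate p K Ob n N \<L> lam D b \<longleftrightarrow>
     is_arg_min (l1_norm_on {..<p})
       (\<lambda>b. linf_norm p
          (\<lambda>j. mat_vec p (Sigma_hat K Ob n N \<L> D) b j - gamma_hat K Ob n \<L> D j) \<le> lam) b"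

text \<open>
  For some data the linear program is infeasible and the estimator is not determined. It is then
  left arbitrary. No measurability is required of the choice of a minimiser.
\<close>

definition is_estimator ::
  "nat \<Rightarrow> nat \<Rightarrow> (nat \<Rightarrow> nat set) \<Rightarrow> (nat \<Rightarrow> nat) \<Rightarrow> nat \<Rightarrow> nat set set \<Rightarrow> real \<Rightarrow>
     (data \<Rightarrow> nat \<Rightarrow> real) \<Rightarrow> bool" where
  "is_estimator p K Ob n N \<L> lam \<beta>hat \<longleftrightarrow>
     (\<forall>D. (\<exists>b. is_estimate p K Ob n N \<L> lam D b) \<longrightarrow> is_estimate p K Ob n N \<L> lam D (\<beta>hat D))"

text \<open>
  For a measurable property Q this says that Q has probability at least q. In general it says
  that the inner probability of Q is at least q.
\<close>

definition with_prob_at_least :: "'a measure \<Rightarrow> real \<Rightarrow> ('a \<Rightarrow> bool) \<Rightarrow> bool" where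
  "with_prob_at_least M q Q \<longleftrightarrow> (\<exists>E\<in>sets M. measure M E \<ge> q \<and> (\<forall>w\<in>E. Q w))"

end

theory Submission
  imports Defs
begin

text \<open>
  The argument has a probabilistic and a deterministic half. Let \<open>\<gamma>\<close> be the expectation of \<open>X Y\<close>.
  The noise has conditional mean 0 given X, so the true coefficients solve \<open>\<Sigma> \<beta> = \<gamma>\<close>.

  Each coordinate of \<open>gamma_hat\<close>, and each coordinate of \<open>Sigma_hat v\<close> for a fixed vector v, is a
  sum of independent contributions, one per observation. Each contribution is a product of two
  variables with Gaussian tails, hence sub-exponential, so the moment generating functions multiply
  and a tail bound of Bernstein type follows (\<open>sub_exponential_data_sum\<close>, \<open>sub_exponential_tail\<close>).
  In \<open>Sigma_hat v\<close> the normalisation differs from entry to entry, but an observation with pattern k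
  still contributes \<open>X\<^sub>j (u\<^sub>k\<^sup>T X)\<close> for one vector \<open>u\<^sub>k\<close>, which collects the observed
  coordinates of v divided by the sample sizes of the entries. In the sum of \<open>|u\<^sub>k|\<^sup>2\<close> over the
  observations, the number of observations behind an entry cancels one of its two divisions by that
  number. The variance proxy is therefore at most a multiple of \<open>|v|\<^sup>2 / m\<close>, where
  \<open>m = \<rho>\<^sup>2 n + N\<close> is a lower bound for all the sample sizes (\<open>Sigma_hat_sub_exponential\<close>).

  Three events of probability at most \<open>2 / p\<close> are excluded: a large deviation of some coordinate
  of \<open>gamma_hat\<close> from \<open>\<gamma>\<close>, of some coordinate of \<open>Sigma_hat \<beta>\<close> from \<open>\<Sigma> \<beta>\<close>, and, with v a
  coordinate vector, of some entry of \<open>Sigma_hat\<close> from that of \<open>\<Sigma>\<close>. On the complement, the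
  first two deviations are at most half the regularisation parameter, so \<open>\<beta>\<close> is feasible for the
  linear program, and the third is at most \<open>\<Phi> / (8 s)\<close>.

  The deterministic half is the usual analysis of the Dantzig selector (\<open>oracle_inequality\<close>).
  A minimiser has an \<open>\<ell>\<^sub>1\<close> norm no larger than that of \<open>\<beta>\<close>, which puts the error d in the cone
  of the restricted eigenvalue condition. Because both points are feasible,
  \<open>d\<^sup>T Sigma_hat d \<le> 2 lam |d|\<^sub>1\<close>. On the cone \<open>|d|\<^sub>1\<^sup>2\<close> is at most \<open>4 s\<close> times the squared
  Euclidean norm of the large coordinates of d, so an entrywise error of \<open>\<Phi> / (8 s)\<close> costs only
  half of the restricted eigenvalue when \<open>\<Sigma>\<close> is replaced by \<open>Sigma_hat\<close>.
\<close>

section \<open>Sub-exponential random variables\<close>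

text \<open>
  The centre \<open>\<mu>\<close>, the variance proxy v and the scale b are separate parameters because a sum of
  independent variables adds the first two and keeps only the largest scale. Centring at a given
  \<open>\<mu>\<close> instead of the expectation means that sums need no integrability argument. With \<open>b = v = 0\<close>
  the bound holds for all \<open>\<tau>\<close> and says that Z is almost surely \<open>\<mu>\<close>, which covers the noiseless
  model with zero coefficients.
\<close>

definition sub_exponential :: "'a measure \<Rightarrow> ('a \<Rightarrow> real) \<Rightarrow> real \<Rightarrow> real \<Rightarrow> real \<Rightarrow> bool" where
  "sub_exponential M Z \<mu> v b \<longleftrightarrow> Z \<in> borel_measurable M \<and>
     (\<forall>\<tau>. \<bar>\<tau>\<bar> * b \<le> 1/2 \<longrightarrow>
        (\<integral>\<^sup>+ w. ennreal (exp (\<tau> * (Z w - \<mu>))) \<partial>M) \<le> ennreal (exp (16 * \<tau>\<^sup>2 * v)))"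

lemma exp_le_quadratic: "exp x \<le> 1 + x + x\<^sup>2 * exp \<bar>x\<bar>" for x :: real
proof -
  have "1 - x \<le> exp (- x)" using exp_ge_add_one_self[of "-x"] by simp
  then have "(1 - x) * exp x \<le> exp (- x) * exp x" by (intro mult_right_mono) auto
  then have 1: "exp x - 1 \<le> x * exp x" by (simp add: algebra_simps flip: exp_add)
  show ?thesis
  proof (cases "x \<ge> 0")
    case True
    then have "x * exp x - x \<le> x * (x * exp x)" using mult_left_mono[OF 1 True] by (simp add: algebra_simps)
    with 1 True show ?thesis by (simp add: power2_eq_square algebra_simps)
  next
    case False
    have "x \<le> exp x - 1" using exp_ge_add_one_self[of x] by linarith
    then have "x * (exp x - 1) \<le> x * x" using False by (intro mult_left_mono_neg) auto
    moreover have "x * x * 1 \<le> x * x * exp \<bar>x\<bar>" by (intro mult_left_mono) auto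
    ultimately show ?thesis using 1 by (simp add: power2_eq_square algebra_simps)
  qed
qed

lemma integrable_of_exp_moment:
  assumes [measurable]: "Z \<in> borel_measurable M" and b: "b > 0"
    and "(\<integral>\<^sup>+ w. ennreal (exp (\<bar>Z w\<bar> / b)) \<partial>M) \<le> 2"
  shows "integrable M (\<lambda>w. exp (\<bar>Z w\<bar> / b))" "(\<integral>w. exp (\<bar>Z w\<bar> / b) \<partial>M) \<le> 2" "integrable M Z"
proof -
  show 1: "integrable M (\<lambda>w. exp (\<bar>Z w\<bar> / b))"
    using assms(3) by (intro integrableI_nonneg) (auto simp: less_top[symmetric] top_unique)
  then have "ennreal (\<integral>w. exp (\<bar>Z w\<bar> / b) \<partial>M) \<le> ennreal 2"
    using assms(3) by (subst nn_integral_eq_integral[symmetric]) auto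
  then show "(\<integral>w. exp (\<bar>Z w\<bar> / b) \<partial>M) \<le> 2" by (subst (asm) ennreal_le_iff) auto
  show "integrable M Z"
  proof (rule Bochner_Integration.integrable_bound[of M "\<lambda>w. b * exp (\<bar>Z w\<bar> / b)"])
    have "\<bar>Z w\<bar> \<le> b * exp (\<bar>Z w\<bar> / b)" for w
    proof -
      have "\<bar>Z w\<bar> / b \<le> exp (\<bar>Z w\<bar> / b)"
        using exp_ge_add_one_self[of "\<bar>Z w\<bar> / b"] by linarith
      with b show ?thesis by (simp add: pos_divide_le_eq mult.commute)
    qed
    then show "AE w in M. norm (Z w) \<le> norm (b * exp (\<bar>Z w\<bar> / b))" using b by auto
  qed (use 1 in auto)
qed

text \<open>
  The first-order term of \<open>exp (\<tau> Z)\<close> integrates to \<open>\<tau> E[Z]\<close> and the factor \<open>exp (- \<tau> E[Z])\<close>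
  removes it at the end, so Z itself never has to be centred inside the exponential moment. The
  remainder is quadratic in \<open>\<tau> b\<close> since half of the exponential moment of \<open>|Z| / b\<close> absorbs
  the factor \<open>(Z / b)\<^sup>2\<close> and the other half absorbs \<open>exp |\<tau> Z|\<close>.
\<close>

lemma sub_exponential_of_exp_moment:
  assumes M: "prob_space M" and Z[measurable]: "Z \<in> borel_measurable M" and b: "b > 0"
    and m: "(\<integral>\<^sup>+ w. ennreal (exp (\<bar>Z w\<bar> / b)) \<partial>M) \<le> 2"
  shows "sub_exponential M Z (\<integral>w. Z w \<partial>M) (b\<^sup>2) b"
  unfolding sub_exponential_def
proof (intro conjI allI impI Z)
  fix \<tau> :: real assume \<tau>: "\<bar>\<tau>\<bar> * b \<le> 1/2"
  interpret prob_space M by fact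
  note I[simp] = integrable_of_exp_moment[OF Z b m]
  define \<mu> where "\<mu> = (\<integral>v. Z v \<partial>M)"
  have pw: "exp (\<tau> * Z w) \<le> 1 + \<tau> * Z w + 8 * (\<tau> * b)\<^sup>2 * exp (\<bar>Z w\<bar> / b)" for w
  proof -
    define y where "y = \<bar>Z w\<bar> / b"
    have y: "y \<ge> 0" "\<bar>\<tau> * Z w\<bar> = (\<bar>\<tau>\<bar> * b) * y" using b by (auto simp: y_def abs_mult)
    have "(y/2)\<^sup>2 / 2 \<le> exp (y/2)" using exp_lower_Taylor_quadratic[of "y/2"] y(1) by simp
    then have 1: "y\<^sup>2 \<le> 8 * exp (y/2)" by (simp add: power_divide)
    have "(\<bar>\<tau>\<bar> * b) * y \<le> (1/2) * y" using \<tau> y(1) by (intro mult_right_mono) auto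
    then have 2: "exp \<bar>\<tau> * Z w\<bar> \<le> exp (y/2)" unfolding y(2) by simp
    have "(\<tau> * Z w)\<^sup>2 * exp \<bar>\<tau> * Z w\<bar> = (\<bar>\<tau> * Z w\<bar>)\<^sup>2 * exp \<bar>\<tau> * Z w\<bar>" by simp
    also have "\<dots> = (\<tau> * b)\<^sup>2 * (y\<^sup>2 * exp \<bar>\<tau> * Z w\<bar>)" unfolding y(2) by (simp add: power_mult_distrib)
    also have "\<dots> \<le> (\<tau> * b)\<^sup>2 * (8 * exp (y/2) * exp (y/2))"
      using 1 2 by (intro mult_left_mono mult_mono) auto
    also have "\<dots> = 8 * (\<tau> * b)\<^sup>2 * exp y" by (simp flip: exp_add)
    finally show ?thesis using exp_le_quadratic[of "\<tau> * Z w"] unfolding y_def by linarith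
  qed
  define h where "h w = 1 + \<tau> * Z w + 8 * (\<tau> * b)\<^sup>2 * exp (\<bar>Z w\<bar> / b)" for w
  have h0: "0 \<le> h w" for w using pw[of w] exp_gt_zero[of "\<tau> * Z w"] unfolding h_def by linarith
  have hI: "integrable M h" unfolding h_def by auto
  have "(\<integral>w. h w \<partial>M) = 1 + \<tau> * \<mu> + 8 * (\<tau> * b)\<^sup>2 * (\<integral>w. exp (\<bar>Z w\<bar> / b) \<partial>M)"
    unfolding h_def \<mu>_def by (simp add: prob_space)
  also have "\<dots> \<le> 1 + \<tau> * \<mu> + 8 * (\<tau> * b)\<^sup>2 * 2"
    by (intro add_left_mono mult_left_mono) auto
  also have "\<dots> \<le> exp (\<tau> * \<mu> + 16 * \<tau>\<^sup>2 * b\<^sup>2)"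
    using exp_ge_add_one_self[of "\<tau> * \<mu> + 16 * \<tau>\<^sup>2 * b\<^sup>2"]
    unfolding power_mult_distrib by linarith
  finally have h2: "(\<integral>w. h w \<partial>M) \<le> exp (\<tau> * \<mu> + 16 * \<tau>\<^sup>2 * b\<^sup>2)" .
  have "(\<integral>\<^sup>+ w. ennreal (exp (\<tau> * (Z w - \<mu>))) \<partial>M)
      = (\<integral>\<^sup>+ w. ennreal (exp (- \<tau> * \<mu>)) * ennreal (exp (\<tau> * Z w)) \<partial>M)"
    by (intro nn_integral_cong) (auto simp: ennreal_mult'[symmetric] algebra_simps simp flip: exp_add)
  also have "\<dots> = ennreal (exp (- \<tau> * \<mu>)) * (\<integral>\<^sup>+ w. ennreal (exp (\<tau> * Z w)) \<partial>M)"
    by (intro nn_integral_cmult) auto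
  also have "(\<integral>\<^sup>+ w. ennreal (exp (\<tau> * Z w)) \<partial>M) \<le> (\<integral>\<^sup>+ w. ennreal (h w) \<partial>M)"
    using pw unfolding h_def by (intro nn_integral_mono ennreal_leI) auto
  also have "\<dots> = ennreal (\<integral>w. h w \<partial>M)" using hI h0 by (intro nn_integral_eq_integral) auto
  also have "\<dots> \<le> ennreal (exp (\<tau> * \<mu> + 16 * \<tau>\<^sup>2 * b\<^sup>2))" using h2 by (rule ennreal_leI)
  also have "ennreal (exp (- \<tau> * \<mu>)) * \<dots> = ennreal (exp (16 * \<tau>\<^sup>2 * b\<^sup>2))"
    by (auto simp: ennreal_mult'[symmetric] simp flip: exp_add)
  finally show "(\<integral>\<^sup>+ w. ennreal (exp (\<tau> * (Z w - (\<integral>v. Z v \<partial>M)))) \<partial>M) \<le> ennreal (exp (16 * \<tau>\<^sup>2 * b\<^sup>2))"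
    unfolding \<mu>_def by (auto simp: mult_left_mono)
qed

lemma sub_exponential_AE_zero:
  assumes M: "prob_space M" and Z[measurable]: "Z \<in> borel_measurable M" and "AE w in M. Z w = 0"
  shows "sub_exponential M Z 0 0 b"
proof -
  interpret prob_space M by fact
  have "(\<integral>\<^sup>+ w. ennreal (exp (\<tau> * Z w)) \<partial>M) = (\<integral>\<^sup>+ w. 1 \<partial>M)" for \<tau>
    using assms(3) by (intro nn_integral_cong_AE) auto
  then show ?thesis unfolding sub_exponential_def by (auto simp: emeasure_space_1)
qed

section \<open>Exponential moments from Orlicz norms and sub-Gaussian noise\<close>

text \<open>
  By the inequality of the arithmetic and geometric means. It is the form in which the triangle
  inequality and the product inequality for Orlicz norms are used.
\<close>

lemma exp_moment_average:
  assumes f: "(\<integral>\<^sup>+ w. ennreal (exp (f w)) \<partial>M) \<le> 2" and g: "(\<integral>\<^sup>+ w. ennreal (exp (g w)) \<partial>M) \<le> 2"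
    and le: "\<And>w. h w \<le> (f w + g w) / 2"
    and [measurable]: "f \<in> borel_measurable M" "g \<in> borel_measurable M"
  shows "(\<integral>\<^sup>+ w. ennreal (exp (h w)) \<partial>M) \<le> 2"
proof -
  have "exp (h w) \<le> (exp (f w) + exp (g w)) / 2" for w
  proof -
    have "exp (h w) \<le> exp (f w / 2) * exp (g w / 2)" 
      using le[of w] by (simp flip: exp_add add: add_divide_distrib)
    also have "\<dots> \<le> ((exp (f w / 2))\<^sup>2 + (exp (g w / 2))\<^sup>2) / 2"
      using sum_squares_bound[of "exp (f w / 2)" "exp (g w / 2)"] by simp
    finally show ?thesis by (simp add: power2_eq_square flip: exp_add)
  qed
  then have "ennreal (exp (h w)) \<le> ennreal (1/2) * (ennreal (exp (f w)) + ennreal (exp (g w)))" for w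
    unfolding ennreal_plus[OF exp_ge_zero exp_ge_zero, symmetric]
    by (subst ennreal_mult'[symmetric]) (auto intro!: ennreal_leI)
  then have "(\<integral>\<^sup>+ w. ennreal (exp (h w)) \<partial>M) \<le> (\<integral>\<^sup>+ w. ennreal (1/2) * (ennreal (exp (f w)) + ennreal (exp (g w))) \<partial>M)"
    by (intro nn_integral_mono)
  also have "\<dots> = ennreal (1/2) * ((\<integral>\<^sup>+ w. ennreal (exp (f w)) \<partial>M) + (\<integral>\<^sup>+ w. ennreal (exp (g w)) \<partial>M))"
    by (simp add: nn_integral_cmult nn_integral_add)
  also have "\<dots> \<le> ennreal (1/2) * (2 + 2)" by (intro mult_left_mono add_mono f g) auto
  also have "\<dots> = ennreal (1/2) * ennreal 4" by simp
  also have "\<dots> = 2" by (subst ennreal_mult'[symmetric]) auto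
  finally show ?thesis .
qed

lemma exp_moment_product:
  assumes U: "(\<integral>\<^sup>+ w. ennreal (exp ((U w)\<^sup>2 / u\<^sup>2)) \<partial>M) \<le> 2" and V: "(\<integral>\<^sup>+ w. ennreal (exp ((V w)\<^sup>2 / v\<^sup>2)) \<partial>M) \<le> 2"
    and "u > 0" "v > 0" and [measurable]: "U \<in> borel_measurable M" "V \<in> borel_measurable M"
  shows "(\<integral>\<^sup>+ w. ennreal (exp (\<bar>U w * V w\<bar> / (u * v))) \<partial>M) \<le> 2"
proof (rule exp_moment_average[OF U V])
  show "\<bar>U w * V w\<bar> / (u * v) \<le> ((U w)\<^sup>2 / u\<^sup>2 + (V w)\<^sup>2 / v\<^sup>2) / 2" for w
    using sum_squares_bound[of "\<bar>U w\<bar> / u" "\<bar>V w\<bar> / v"] assms(3,4)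
    by (simp add: power_divide abs_mult mult_ac)
qed auto

text \<open>
  The factor 2 leaves room for an infimum that is not known to be attained.
\<close>

lemma exp_square_moment_of_psi2_norm_le:
  assumes "psi2_norm M Z \<le> ennreal R" "R > 0"
  shows "(\<integral>\<^sup>+ w. ennreal (exp ((Z w)\<^sup>2 / (2 * R)\<^sup>2)) \<partial>M) \<le> 2"
proof -
  have "psi2_norm M Z < ennreal (2 * R)" 
    using assms by (intro le_less_trans[OF assms(1)]) (auto simp: ennreal_less_iff)
  then obtain c where c: "c > 0" "c < 2 * R" "(\<integral>\<^sup>+ w. ennreal (exp ((Z w)\<^sup>2 / c\<^sup>2)) \<partial>M) \<le> 2"
    unfolding psi2_norm_def Inf_less_iff by (auto simp: ennreal_less_iff)
  have "(Z w)\<^sup>2 / (2 * R)\<^sup>2 \<le> (Z w)\<^sup>2 / c\<^sup>2" for w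
    using c by (intro divide_left_mono power_mono) auto
  then have "(\<integral>\<^sup>+ w. ennreal (exp ((Z w)\<^sup>2 / (2 * R)\<^sup>2)) \<partial>M) \<le> (\<integral>\<^sup>+ w. ennreal (exp ((Z w)\<^sup>2 / c\<^sup>2)) \<partial>M)"
    by (intro nn_integral_mono ennreal_leI) auto
  with c(3) show ?thesis by (rule order_trans[rotated])
qed

lemma exp_square_moment_inner:
  assumes M: "prob_space M" and R: "psi2_norm_vec p M X \<le> ennreal R" "R > 0"
    and c: "c > 0" "2 * R * L2_set u {..<p} \<le> c"
  shows "(\<integral>\<^sup>+ w. ennreal (exp ((inner_p p u (X w))\<^sup>2 / c\<^sup>2)) \<partial>M) \<le> 2"
proof (cases "L2_set u {..<p} = 0")
  case True
  then have "inner_p p u x = 0" for x by (auto simp: inner_p_def L2_set_eq_0_iff)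
  then show ?thesis using prob_space.emeasure_space_1[OF M] by simp
next
  case False
  define r where "r = L2_set u {..<p}"
  have r: "r > 0" using False L2_set_nonneg[of u "{..<p}"] by (auto simp: r_def less_le)
  have "L2_set (\<lambda>j. (1/r) * u j) {..<p} = 1"
    using r by (subst L2_set_right_distrib[symmetric]) (auto simp: r_def)
  then have "psi2_norm M (\<lambda>w. inner_p p (\<lambda>j. (1/r) * u j) (X w)) \<le> psi2_norm_vec p M X"
    unfolding psi2_norm_vec_def by (intro SUP_upper) auto
  also note R(1)
  finally have "(\<integral>\<^sup>+ w. ennreal (exp ((inner_p p (\<lambda>j. (1/r) * u j) (X w))\<^sup>2 / (2*R)\<^sup>2)) \<partial>M) \<le> 2"
    using R(2) by (rule exp_square_moment_of_psi2_norm_le)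
  moreover have "(inner_p p u (X w))\<^sup>2 / c\<^sup>2 \<le> (inner_p p (\<lambda>j. (1/r) * u j) (X w))\<^sup>2 / (2*R)\<^sup>2" for w
  proof -
    have e: "inner_p p (\<lambda>j. (1/r) * u j) (X w) = inner_p p u (X w) / r"
      by (simp add: inner_p_def sum_divide_distrib)
    have "(inner_p p u (X w))\<^sup>2 / c\<^sup>2 \<le> (inner_p p u (X w))\<^sup>2 / (2 * R * r)\<^sup>2"
      using c r R(2) by (intro divide_left_mono power_mono) (auto simp: r_def)
    then show ?thesis unfolding e by (simp add: power_divide power_mult_distrib algebra_simps)
  qed
  then have "(\<integral>\<^sup>+ w. ennreal (exp ((inner_p p u (X w))\<^sup>2 / c\<^sup>2)) \<partial>M) 
     \<le> (\<integral>\<^sup>+ w. ennreal (exp ((inner_p p (\<lambda>j. (1/r) * u j) (X w))\<^sup>2 / (2*R)\<^sup>2)) \<partial>M)"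
    by (intro nn_integral_mono ennreal_leI) auto
  ultimately show ?thesis by (rule order_trans[rotated])
qed

lemma even_power_le_cosh: "x ^ (2 * k) / fact (2 * k) \<le> (exp x + exp (- x)) / 2" for x :: real
proof -
  have g: "(\<lambda>n. if even n then x ^ n / fact n else 0) sums cosh x"
    using cosh_converges[of x] by (simp add: divide_inverse mult.commute scaleR_conv_of_real cong: if_cong)
  have f: "(\<lambda>n. if n = 2 * k then x ^ n / fact n else 0) sums (x ^ (2*k) / fact (2*k))"
    using sums_single[of "2*k" "\<lambda>n. x ^ n / fact n"] by simp
  have "x ^ (2*k) / fact (2*k) \<le> cosh x"
    by (rule sums_le[OF _ f g]) (auto simp: zero_le_even_power)
  then show ?thesis by (simp add: cosh_def scaleR_conv_of_real add_divide_distrib)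
qed

lemma fact_double_le: "fact (2 * k) \<le> (2 * real k) ^ k * fact k"
proof -
  have "j \<le> k \<Longrightarrow> fact (k + j) \<le> (2 * real k) ^ j * fact k" for j
  proof (induction j)
    case (Suc j)
    have "(fact (k + Suc j) :: real) = (real k + real j + 1) * fact (k + j)" by (simp add: algebra_simps)
    also have "\<dots> \<le> (2 * real k) * ((2 * real k) ^ j * fact k)"
      using Suc by (intro mult_mono) auto
    finally show ?case by (simp add: algebra_simps)
  qed simp
  from this[of k] show ?thesis unfolding mult_2[of k] by simp
qed

text \<open>
  The series of \<open>exp (Z\<^sup>2 / c\<^sup>2)\<close> is integrated term by term. An even moment is bounded by
  a multiple of \<open>exp (t Z) + exp (- t Z)\<close> with its own t, chosen of order \<open>sqrt k\<close> to be
  nearly optimal for the 2k-th moment. The k-th term of the series is then at most \<open>(e / 6)\<^sup>k\<close>,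
  and \<open>e \<le> 3\<close>.
\<close>

lemma exp_square_moment_of_sub_gaussian:
  assumes [measurable]: "Z \<in> borel_measurable M" and M: "prob_space M"
    and sg: "sub_gaussian M Z \<sigma>" and c: "c > 0" "6 * \<sigma>\<^sup>2 \<le> c\<^sup>2"
  shows "(\<integral>\<^sup>+ w. ennreal (exp ((Z w)\<^sup>2 / c\<^sup>2)) \<partial>M) \<le> 2"
proof -
  interpret prob_space M by fact
  have term_le: "(\<integral>\<^sup>+ w. ennreal (((Z w)\<^sup>2 / c\<^sup>2) ^ k / fact k) \<partial>M) \<le> ennreal ((1/2) ^ k)" for k
  proof (cases "k = 0")
    case True then show ?thesis by (simp add: emeasure_space_1)
  next
    case False
    then have k: "real k > 0" by simp
    \<comment> \<open>with this choice \<open>t\<^sup>2 \<sigma>\<^sup>2 / 2 \<le> k\<close>, because \<open>6 \<sigma>\<^sup>2 \<le> c\<^sup>2\<close>\<close>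
    define t where "t = sqrt (12 * real k) / c"
    have t: "t > 0" "t\<^sup>2 = 12 * real k / c\<^sup>2" using k c by (auto simp: t_def power_divide)
    have "t\<^sup>2 * \<sigma>\<^sup>2 / 2 = real k * (6 * \<sigma>\<^sup>2 / c\<^sup>2)" using t by simp
    also have "\<dots> \<le> real k * 1" using c by (intro mult_left_mono) auto
    finally have e: "exp (t\<^sup>2 * \<sigma>\<^sup>2 / 2) \<le> exp (real k)" by simp
    define a where "a = fact (2 * k) / (t ^ (2*k) * c ^ (2*k) * fact k)"
    have a0: "a > 0" using t c by (auto simp: a_def)
    have pw: "((Z w)\<^sup>2 / c\<^sup>2) ^ k / fact k \<le> a / 2 * (exp (t * Z w) + exp (- t * Z w))" for w
    proof -
      have "((Z w)\<^sup>2 / c\<^sup>2) ^ k / fact k = a * ((t * Z w) ^ (2 * k) / fact (2 * k))"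
        using t(1) c False by (simp add: a_def power_mult power_divide power_mult_distrib)
      also have "\<dots> \<le> a * ((exp (t * Z w) + exp (- (t * Z w))) / 2)"
        using a0 by (intro mult_left_mono even_power_le_cosh) auto
      finally show ?thesis by simp
    qed
    have "(\<integral>\<^sup>+ w. ennreal (((Z w)\<^sup>2 / c\<^sup>2) ^ k / fact k) \<partial>M)
      \<le> (\<integral>\<^sup>+ w. ennreal (a / 2) * (ennreal (exp (t * Z w)) + ennreal (exp (- t * Z w))) \<partial>M)"
      using pw a0 by (intro nn_integral_mono)
        (auto simp: ennreal_mult'[symmetric] ennreal_plus[symmetric] simp del: ennreal_plus intro!: ennreal_leI)
    also have "\<dots> = ennreal (a/2) * ((\<integral>\<^sup>+ w. ennreal (exp (t * Z w)) \<partial>M) + (\<integral>\<^sup>+ w. ennreal (exp (- t * Z w)) \<partial>M))"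
      by (simp add: nn_integral_cmult nn_integral_add)
    also have "\<dots> \<le> ennreal (a/2) * (ennreal (exp (t\<^sup>2 * \<sigma>\<^sup>2 / 2)) + ennreal (exp ((-t)\<^sup>2 * \<sigma>\<^sup>2 / 2)))"
      using sg[unfolded sub_gaussian_def] by (intro mult_left_mono add_mono) (blast, blast, simp)
    also have "\<dots> = ennreal (a * exp (t\<^sup>2 * \<sigma>\<^sup>2 / 2))"
      using a0 by (simp add: ennreal_mult'[symmetric] ennreal_plus[symmetric] del: ennreal_plus)
    also have "a * exp (t\<^sup>2 * \<sigma>\<^sup>2 / 2) \<le> ((2 * real k) ^ k / ((12 * real k) ^ k)) * 3 ^ k"
    proof (intro mult_mono)
      have "a \<le> (2 * real k) ^ k * fact k / (t ^ (2*k) * c ^ (2*k) * fact k)"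
        unfolding a_def using t c by (intro divide_right_mono fact_double_le) auto
      also have "\<dots> = (2 * real k) ^ k / ((t\<^sup>2 * c\<^sup>2) ^ k)"
        by (simp add: power_mult power_mult_distrib)
      also have "t\<^sup>2 * c\<^sup>2 = 12 * real k" using t c by simp
      finally show "a \<le> (2 * real k) ^ k / ((12 * real k) ^ k)" .
      have "exp (t\<^sup>2 * \<sigma>\<^sup>2 / 2) \<le> exp 1 ^ k" using e by (simp flip: exp_of_nat_mult)
      also have "\<dots> \<le> 3 ^ k" using exp_le by (intro power_mono) auto
      finally show "exp (t\<^sup>2 * \<sigma>\<^sup>2 / 2) \<le> 3 ^ k" .
    qed auto
    also have "((2 * real k) ^ k / ((12 * real k) ^ k)) * 3 ^ k = (1/2) ^ k"
    proof -
      have "((2 * real k) ^ k / ((12 * real k) ^ k)) * 3 ^ k = (2 * real k / (12 * real k) * 3) ^ k"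
        by (simp only: power_divide power_mult_distrib)
      also have "2 * real k / (12 * real k) * 3 = 1/2" using k by simp
      finally show ?thesis .
    qed
    finally show ?thesis by (simp add: ennreal_leI)
  qed
  have "ennreal (exp x) = (\<Sum>k. ennreal (x ^ k / fact k))" if "x \<ge> 0" for x :: real
    using exp_converges[of x] that
    by (intro suminf_ennreal_eq[symmetric]) (auto simp: divide_inverse mult.commute)
  then have "(\<integral>\<^sup>+ w. ennreal (exp ((Z w)\<^sup>2 / c\<^sup>2)) \<partial>M)
      = (\<integral>\<^sup>+ w. (\<Sum>k. ennreal (((Z w)\<^sup>2 / c\<^sup>2) ^ k / fact k)) \<partial>M)" by simp
  also have "\<dots> = (\<Sum>k. \<integral>\<^sup>+ w. ennreal (((Z w)\<^sup>2 / c\<^sup>2) ^ k / fact k) \<partial>M)"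
    by (intro nn_integral_suminf) auto
  also have "\<dots> \<le> (\<Sum>k. ennreal ((1/2) ^ k))" by (intro suminf_le term_le) auto
  also have "\<dots> = ennreal 2" using geometric_sums[of "1/2::real"] by (intro suminf_ennreal_eq) auto
  finally show ?thesis by simp
qed

text \<open>
  Because \<open>exp z + exp (- z) \<ge> 2 + z\<^sup>2\<close>, the second moment must vanish.
\<close>

lemma AE_zero_of_mgf_le_1:
  assumes M: "prob_space M" and [measurable]: "Z \<in> borel_measurable M"
    and "(\<integral>\<^sup>+ w. ennreal (exp (Z w)) \<partial>M) \<le> 1" "(\<integral>\<^sup>+ w. ennreal (exp (- Z w)) \<partial>M) \<le> 1"
  shows "AE w in M. Z w = 0"
proof -
  interpret prob_space M by fact
  have "2 + (Z w)\<^sup>2 \<le> exp (Z w) + exp (- Z w)" for w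
  proof -
    have "(\<lambda>n. if even n then (Z w) ^ n / fact n else 0) sums cosh (Z w)"
      using cosh_converges[of "Z w"] by (simp add: divide_inverse mult.commute scaleR_conv_of_real cong: if_cong)
    then have "(\<Sum>n<3. if even n then (Z w) ^ n / fact n else 0) \<le> cosh (Z w)"
      by (subst sums_unique, assumption, intro sum_le_suminf)
        (auto simp: zero_le_even_power sums_iff)
    then show ?thesis by (simp add: numeral_eq_Suc cosh_def field_simps)
  qed
  then have "(\<integral>\<^sup>+ w. 2 + ennreal ((Z w)\<^sup>2) \<partial>M) \<le> (\<integral>\<^sup>+ w. ennreal (exp (Z w)) + ennreal (exp (- Z w)) \<partial>M)"
    by (intro nn_integral_mono)
      (auto simp: ennreal_plus[symmetric] ennreal_numeral[symmetric] simp del: ennreal_plus ennreal_numeral intro!: ennreal_leI)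
  also have "\<dots> = (\<integral>\<^sup>+ w. ennreal (exp (Z w)) \<partial>M) + (\<integral>\<^sup>+ w. ennreal (exp (- Z w)) \<partial>M)"
    by (rule nn_integral_add) auto
  also have "\<dots> \<le> 1 + 1" using assms(3,4) by (rule add_mono)
  finally have "2 + (\<integral>\<^sup>+ w. ennreal ((Z w)\<^sup>2) \<partial>M) \<le> 2 + 0"
    by (simp add: nn_integral_add emeasure_space_1)
  then have "(\<integral>\<^sup>+ w. ennreal ((Z w)\<^sup>2) \<partial>M) = 0"
    by (subst (asm) ennreal_add_left_cancel_le) auto
  then show ?thesis by (subst (asm) nn_integral_0_iff_AE) auto
qed

section \<open>Independent sums and tails\<close>

lemma sub_exponential_mono:
  assumes "sub_exponential M Z \<mu> v b" "v \<le> v'" "b \<le> b'"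
  shows "sub_exponential M Z \<mu> v' b'"
  unfolding sub_exponential_def
proof (intro conjI allI impI)
  fix \<tau> :: real assume "\<bar>\<tau>\<bar> * b' \<le> 1/2"
  moreover have "\<bar>\<tau>\<bar> * b \<le> \<bar>\<tau>\<bar> * b'" using assms(3) by (rule mult_left_mono) auto
  ultimately have "(\<integral>\<^sup>+ w. ennreal (exp (\<tau> * (Z w - \<mu>))) \<partial>M) \<le> ennreal (exp (16 * \<tau>\<^sup>2 * v))"
    using assms(1) unfolding sub_exponential_def by auto
  also have "\<dots> \<le> ennreal (exp (16 * \<tau>\<^sup>2 * v'))" using assms(2) by (auto intro!: ennreal_leI mult_left_mono)
  finally show "(\<integral>\<^sup>+ w. ennreal (exp (\<tau> * (Z w - \<mu>))) \<partial>M) \<le> ennreal (exp (16 * \<tau>\<^sup>2 * v'))" .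
qed (use assms in \<open>auto simp: sub_exponential_def\<close>)

lemma sub_exponential_scale:
  assumes "sub_exponential M Z \<mu> v b"
  shows "sub_exponential M (\<lambda>w. a * Z w) (a * \<mu>) (a\<^sup>2 * v) (\<bar>a\<bar> * b)"
  unfolding sub_exponential_def
proof (intro conjI allI impI)
  fix \<tau> :: real assume "\<bar>\<tau>\<bar> * (\<bar>a\<bar> * b) \<le> 1/2"
  then have "\<bar>\<tau> * a\<bar> * b \<le> 1/2" by (simp add: abs_mult mult.assoc)
  then have "(\<integral>\<^sup>+ w. ennreal (exp ((\<tau> * a) * (Z w - \<mu>))) \<partial>M) \<le> ennreal (exp (16 * (\<tau> * a)\<^sup>2 * v))"
    using assms unfolding sub_exponential_def by blast
  then show "(\<integral>\<^sup>+ w. ennreal (exp (\<tau> * (a * Z w - a * \<mu>))) \<partial>M) \<le> ennreal (exp (16 * \<tau>\<^sup>2 * (a\<^sup>2 * v)))"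
    by (simp add: algebra_simps power_mult_distrib)
qed (use assms in \<open>auto simp: sub_exponential_def\<close>)

lemma sub_exponential_distr:
  assumes [measurable]: "T \<in> measurable M N" "Z \<in> borel_measurable N"
    and "sub_exponential M (\<lambda>w. Z (T w)) \<mu> v b"
  shows "sub_exponential (distr M N T) Z \<mu> v b"
  using assms(3) unfolding sub_exponential_def by (auto simp: nn_integral_distr)

lemma sub_exponential_sum_PiM:
  assumes I: "finite I" and M: "\<And>i. i \<in> I \<Longrightarrow> prob_space (M i)"
    and Z: "\<And>i. i \<in> I \<Longrightarrow> sub_exponential (M i) (Z i) (\<mu> i) (v i) b"
  shows "sub_exponential (PiM I M) (\<lambda>x. \<Sum>i\<in>I. Z i (x i)) (\<Sum>i\<in>I. \<mu> i) (\<Sum>i\<in>I. v i) b"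
  unfolding sub_exponential_def
proof (intro conjI allI impI)
  have meas: "Z i \<in> borel_measurable (M i)" if "i \<in> I" for i
    using Z[OF that] unfolding sub_exponential_def by auto
  then show "(\<lambda>x. \<Sum>i\<in>I. Z i (x i)) \<in> borel_measurable (PiM I M)"
    by (intro borel_measurable_sum measurable_compose[OF measurable_component_singleton]) auto
  fix \<tau> :: real assume \<tau>: "\<bar>\<tau>\<bar> * b \<le> 1/2"
  \<comment> \<open>the product rule for integrals asks for \<open>\<sigma>\<close>-finite factors at every index, also outside I\<close>
  define M' where "M' i = (if i \<in> I then M i else return (count_space UNIV) undefined)" for i
  have "PiM I M = PiM I M'" by (intro PiM_cong) (auto simp: M'_def)
  interpret prob_space "M' i" for i using M by (auto simp: M'_def intro!: prob_space_return)
  interpret product_sigma_finite M' by unfold_locales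
  let ?f = "\<lambda>i y. ennreal (exp (\<tau> * (Z i y - \<mu> i)))"
  have "(\<integral>\<^sup>+ x. ennreal (exp (\<tau> * ((\<Sum>i\<in>I. Z i (x i)) - (\<Sum>i\<in>I. \<mu> i)))) \<partial>PiM I M)
      = (\<integral>\<^sup>+ x. (\<Prod>i\<in>I. ?f i (x i)) \<partial>PiM I M')"
    unfolding \<open>PiM I M = PiM I M'\<close>
    by (intro nn_integral_cong) (simp add: prod_ennreal sum_subtractf[symmetric] sum_distrib_left exp_sum I)
  also have "\<dots> = (\<Prod>i\<in>I. integral\<^sup>N (M' i) (?f i))"
    using meas by (intro product_nn_integral_prod I) (auto simp: M'_def)
  also have "\<dots> = (\<Prod>i\<in>I. integral\<^sup>N (M i) (?f i))"
    by (intro prod.cong) (auto simp: M'_def)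
  also have "\<dots> \<le> (\<Prod>i\<in>I. ennreal (exp (16 * \<tau>\<^sup>2 * v i)))"
    using Z \<tau> by (intro prod_mono_ennreal) (auto simp: sub_exponential_def)
  also have "\<dots> = ennreal (exp (16 * \<tau>\<^sup>2 * (\<Sum>i\<in>I. v i)))"
    by (simp add: prod_ennreal sum_distrib_left exp_sum I)
  finally show "(\<integral>\<^sup>+ x. ennreal (exp (\<tau> * ((\<Sum>i\<in>I. Z i (x i)) - (\<Sum>i\<in>I. \<mu> i)))) \<partial>PiM I M)
      \<le> ennreal (exp (16 * \<tau>\<^sup>2 * (\<Sum>i\<in>I. v i)))" .
qed

lemma sub_exponential_add_pair:
  assumes M: "prob_space M" and N: "prob_space N"
    and Z: "sub_exponential M Z \<mu> v b" and W: "sub_exponential N W \<nu> u b"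
  shows "sub_exponential (M \<Otimes>\<^sub>M N) (\<lambda>(x, y). Z x + W y) (\<mu> + \<nu>) (v + u) b"
  unfolding sub_exponential_def
proof (intro conjI allI impI)
  have [measurable]: "Z \<in> borel_measurable M" "W \<in> borel_measurable N"
    using Z W unfolding sub_exponential_def by auto
  show "(\<lambda>(x, y). Z x + W y) \<in> borel_measurable (M \<Otimes>\<^sub>M N)" by measurable
  fix \<tau> :: real assume \<tau>: "\<bar>\<tau>\<bar> * b \<le> 1/2"
  interpret N: prob_space N by fact
  have "(\<integral>\<^sup>+ p. ennreal (exp (\<tau> * ((case p of (x, y) \<Rightarrow> Z x + W y) - (\<mu> + \<nu>)))) \<partial>(M \<Otimes>\<^sub>M N))
     = (\<integral>\<^sup>+ x. (\<integral>\<^sup>+ y. ennreal (exp (\<tau> * (Z x - \<mu>))) * ennreal (exp (\<tau> * (W y - \<nu>))) \<partial>N) \<partial>M)"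
    by (subst N.nn_integral_fst[symmetric])
      (auto simp: ennreal_mult'[symmetric] algebra_simps simp flip: exp_add intro!: nn_integral_cong)
  also have "\<dots> = (\<integral>\<^sup>+ x. ennreal (exp (\<tau> * (Z x - \<mu>))) \<partial>M) * (\<integral>\<^sup>+ y. ennreal (exp (\<tau> * (W y - \<nu>))) \<partial>N)"
    by (simp add: nn_integral_cmult nn_integral_multc)
  also have "\<dots> \<le> ennreal (exp (16 * \<tau>\<^sup>2 * v)) * ennreal (exp (16 * \<tau>\<^sup>2 * u))"
    using Z W \<tau> by (intro mult_mono) (auto simp: sub_exponential_def)
  also have "\<dots> = ennreal (exp (16 * \<tau>\<^sup>2 * (v + u)))"
    by (simp add: ennreal_mult'[symmetric] ring_distribs flip: exp_add)
  finally show "(\<integral>\<^sup>+ p. ennreal (exp (\<tau> * ((case p of (x, y) \<Rightarrow> Z x + W y) - (\<mu> + \<nu>)))) \<partial>(M \<Otimes>\<^sub>M N))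
     \<le> ennreal (exp (16 * \<tau>\<^sup>2 * (v + u)))" .
qed

text \<open>
  The Chernoff bound on both sides. The optimal \<open>\<tau>\<close> depends on whether the variance or the scale
  dominates; as a parameter it can be chosen to suit the regime of the application.
\<close>

lemma sub_exponential_tail:
  assumes M: "prob_space M" and Z: "sub_exponential M Z \<mu> v b" and \<tau>: "0 \<le> \<tau>" "\<tau> * b \<le> 1/2"
  shows "measure M {w \<in> space M. \<bar>Z w - \<mu>\<bar> > t} \<le> 2 * exp (16 * \<tau>\<^sup>2 * v - \<tau> * t)"
proof -
  interpret prob_space M by fact
  have [measurable]: "Z \<in> borel_measurable M" using Z unfolding sub_exponential_def by auto
  have one_sided: "measure M {w \<in> space M. \<theta> * (Z w - \<mu>) \<ge> \<tau> * t} \<le> exp (16 * \<tau>\<^sup>2 * v - \<tau> * t)"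
    if \<theta>: "\<bar>\<theta>\<bar> = \<tau>" for \<theta>
  proof -
    have "{w \<in> space M. \<theta> * (Z w - \<mu>) \<ge> \<tau> * t}
        = {w \<in> space M. 1 \<le> ennreal (exp (- \<tau> * t)) * ennreal (exp (\<theta> * (Z w - \<mu>)))}"
      by (auto simp: ennreal_mult'[symmetric] simp flip: exp_add)
    then have "emeasure M {w \<in> space M. \<theta> * (Z w - \<mu>) \<ge> \<tau> * t}
      \<le> ennreal (exp (- \<tau> * t)) * (\<integral>\<^sup>+ w. ennreal (exp (\<theta> * (Z w - \<mu>))) * indicator (space M) w \<partial>M)"
      by (simp only:) (rule nn_integral_Markov_inequality; measurable)
    also have "(\<integral>\<^sup>+ w. ennreal (exp (\<theta> * (Z w - \<mu>))) * indicator (space M) w \<partial>M)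
      = (\<integral>\<^sup>+ w. ennreal (exp (\<theta> * (Z w - \<mu>))) \<partial>M)"
      by (intro nn_integral_cong) auto
    also have "\<dots> \<le> ennreal (exp (16 * \<theta>\<^sup>2 * v))"
      using Z \<tau> \<theta> unfolding sub_exponential_def by auto
    also have "\<theta>\<^sup>2 = \<tau>\<^sup>2" using \<theta> by (metis power2_abs)
    also have "ennreal (exp (- \<tau> * t)) * ennreal (exp (16 * \<tau>\<^sup>2 * v)) = ennreal (exp (16 * \<tau>\<^sup>2 * v - \<tau> * t))"
      by (simp add: ennreal_mult'[symmetric] flip: exp_add)
    finally show ?thesis by (simp add: emeasure_eq_measure mult_left_mono)
  qed
  have "{w \<in> space M. \<bar>Z w - \<mu>\<bar> > t} \<subseteq> {w \<in> space M. \<tau> * (Z w - \<mu>) \<ge> \<tau> * t} \<union> {w \<in> space M. - \<tau> * (Z w - \<mu>) \<ge> \<tau> * t}"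
  proof
    fix w assume w: "w \<in> {w \<in> space M. \<bar>Z w - \<mu>\<bar> > t}"
    then have "Z w - \<mu> \<ge> t \<or> - (Z w - \<mu>) \<ge> t" by auto
    then have "\<tau> * (Z w - \<mu>) \<ge> \<tau> * t \<or> \<tau> * (- (Z w - \<mu>)) \<ge> \<tau> * t" using \<tau>(1) mult_left_mono by blast
    then show "w \<in> {w \<in> space M. \<tau> * (Z w - \<mu>) \<ge> \<tau> * t} \<union> {w \<in> space M. - \<tau> * (Z w - \<mu>) \<ge> \<tau> * t}"
      using w unfolding mult_minus_left mult_minus_right by blast
  qed
  then have "measure M {w \<in> space M. \<bar>Z w - \<mu>\<bar> > t}
    \<le> measure M ({w \<in> space M. \<tau> * (Z w - \<mu>) \<ge> \<tau> * t} \<union> {w \<in> space M. - \<tau> * (Z w - \<mu>) \<ge> \<tau> * t})"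
    by (intro finite_measure_mono) auto
  also have "\<dots> \<le> measure M {w \<in> space M. \<tau> * (Z w - \<mu>) \<ge> \<tau> * t} + measure M {w \<in> space M. - \<tau> * (Z w - \<mu>) \<ge> \<tau> * t}"
    by (intro measure_Un_le) measurable
  also have "\<dots> \<le> 2 * exp (16 * \<tau>\<^sup>2 * v - \<tau> * t)"
    using one_sided[of \<tau>] one_sided[of "-\<tau>"] \<tau>(1) by simp
  finally show ?thesis .
qed

lemma sub_exponential_0_AE:
  assumes M: "prob_space M" and Z: "sub_exponential M Z \<mu> 0 0"
  shows "AE w in M. Z w = \<mu>"
proof -
  have "(\<integral>\<^sup>+ w. ennreal (exp (\<tau> * (Z w - \<mu>))) \<partial>M) \<le> 1" for \<tau>
    using Z unfolding sub_exponential_def by auto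
  from this[of 1] this[of "-1"] have "AE w in M. Z w - \<mu> = 0"
    using Z by (intro AE_zero_of_mgf_le_1 M) (auto simp: sub_exponential_def)
  then show ?thesis by auto
qed

lemma measurable_lab:
  assumes "sets P = sets (RN p \<Otimes>\<^sub>M (borel :: real measure))" "S \<subseteq> {..<p}"
  shows "(\<lambda>(x, y). (restrict x S, y)) \<in> measurable P (PiM S (\<lambda>_. borel) \<Otimes>\<^sub>M borel)"
proof -
  have [measurable]: "(\<lambda>x. restrict x S) \<in> measurable (RN p) (PiM S (\<lambda>_. borel))"
    using assms(2) by (rule measurable_restrict_subset)
  have "(\<lambda>(x, y). (restrict x S, y)) \<in> measurable (RN p \<Otimes>\<^sub>M (borel :: real measure)) (PiM S (\<lambda>_. borel) \<Otimes>\<^sub>M borel)"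
    by measurable
  then show ?thesis by (simp cong: measurable_cong_sets add: measurable_cong_sets[OF assms(1) refl])
qed

lemma measurable_fst_P:
  assumes "sets P = sets (RN p \<Otimes>\<^sub>M (borel :: real measure))"
  shows "fst \<in> measurable P (RN p)" "snd \<in> borel_measurable P"
  by (simp_all add: measurable_cong_sets[OF assms refl])

lemma finite_lab_idx[simp]: "finite (lab_idx K n)" by (simp add: lab_idx_def)

lemma Ob_lab_idx_subset: "\<forall>k<K. Ob k \<subseteq> {..<p} \<Longrightarrow> i \<in> lab_idx K n \<Longrightarrow> Ob (fst i) \<subseteq> {..<p}"
  unfolding lab_idx_def by fastforce

lemma data_law_parts:
  assumes P: "prob_space P" "sets P = sets (RN p \<Otimes>\<^sub>M (borel :: real measure))" and Ob: "\<forall>k<K. Ob k \<subseteq> {..<p}"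
  shows "i \<in> lab_idx K n \<Longrightarrow> prob_space (lab_law P (Ob (fst i)))"
    "prob_space (PiM (lab_idx K n) (\<lambda>i. lab_law P (Ob (fst i))))"
    "prob_space (distr P (RN p) fst)"
    "prob_space (PiM {..<N} (\<lambda>_. distr P (RN p) fst))"
    "prob_space (data_law p K Ob n N P)"
proof -
  interpret P: prob_space P by fact
  have 1: "prob_space (lab_law P (Ob (fst i)))" if "i \<in> lab_idx K n" for i
    using Ob_lab_idx_subset[OF Ob that] unfolding lab_law_def
    by (intro P.prob_space_distr measurable_lab[OF P(2)])
  then show "i \<in> lab_idx K n \<Longrightarrow> prob_space (lab_law P (Ob (fst i)))" .
  show 2: "prob_space (PiM (lab_idx K n) (\<lambda>i. lab_law P (Ob (fst i))))"
    by (intro prob_space_PiM 1)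
  show 3: "prob_space (distr P (RN p) fst)"
    by (intro P.prob_space_distr measurable_fst_P P)
  then show 4: "prob_space (PiM {..<N} (\<lambda>_. distr P (RN p) fst))"
    by (intro prob_space_PiM)
  show "prob_space (data_law p K Ob n N P)" unfolding data_law_def
    using 2 4 by (simp add: pair_prob_space.intro pair_sigma_finite.intro prob_space_imp_sigma_finite
        prob_space_pair)
qed

text \<open>
  The summands F see a labelled observation after the missing coordinates have been erased, while
  their moments are computed under the law P of complete observations.
\<close>

lemma sub_exponential_data_sum:
  assumes P: "prob_space P" "sets P = sets (RN p \<Otimes>\<^sub>M (borel :: real measure))" and Ob: "\<forall>k<K. Ob k \<subseteq> {..<p}"
    and F: "\<And>i. i \<in> lab_idx K n \<Longrightarrow> F i \<in> borel_measurable (PiM (Ob (fst i)) (\<lambda>_. borel) \<Otimes>\<^sub>M borel)"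
      "\<And>i. i \<in> lab_idx K n \<Longrightarrow> sub_exponential P (\<lambda>(x, y). F i (restrict x (Ob (fst i)), y)) (\<mu> i) (v i) b"
    and G: "G \<in> borel_measurable (RN p)" "sub_exponential P (\<lambda>w. G (fst w)) \<nu> u b"
  shows "sub_exponential (data_law p K Ob n N P)
      (\<lambda>(lab, unl). (\<Sum>i\<in>lab_idx K n. F i (lab i)) + (\<Sum>k<N. G (unl k)))
      ((\<Sum>i\<in>lab_idx K n. \<mu> i) + real N * \<nu>) ((\<Sum>i\<in>lab_idx K n. v i) + real N * u) b"
proof -
  note parts = data_law_parts[OF P Ob]
  have "sub_exponential (lab_law P (Ob (fst i))) (F i) (\<mu> i) (v i) b" if i: "i \<in> lab_idx K n" for i
    unfolding lab_law_def using Ob_lab_idx_subset[OF Ob i] F[OF i]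
    by (intro sub_exponential_distr measurable_lab[OF P(2)]) (auto simp: split_def)
  then have 1: "sub_exponential (PiM (lab_idx K n) (\<lambda>i. lab_law P (Ob (fst i)))) (\<lambda>lab. \<Sum>i\<in>lab_idx K n. F i (lab i))
      (\<Sum>i\<in>lab_idx K n. \<mu> i) (\<Sum>i\<in>lab_idx K n. v i) b"
    by (intro sub_exponential_sum_PiM parts) auto
  have "sub_exponential (distr P (RN p) fst) G \<nu> u b"
    using G by (intro sub_exponential_distr measurable_fst_P[OF P(2)])
  then have "sub_exponential (PiM {..<N} (\<lambda>_. distr P (RN p) fst)) (\<lambda>unl. \<Sum>k<N. G (unl k)) (\<Sum>k<N. \<nu>) (\<Sum>k<N. u) b"
    by (intro sub_exponential_sum_PiM parts) auto
  with 1 show ?thesis unfolding data_law_def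
    using sub_exponential_add_pair[OF parts(2,4)] by simp
qed

section \<open>Counting observations\<close>

lemma sum_lab_idx: "(\<Sum>i\<in>lab_idx K n. f (fst i)) = (\<Sum>k<K. real (n k) * f k)"
  for f :: "nat \<Rightarrow> real"
  unfolding lab_idx_def using sum.Sigma[of "{..<K}" "\<lambda>k. {..<n k}" "\<lambda>k _. f k"] by (simp add: split_def)

text \<open>
  This is why the sample sizes counted by modality are the sample sizes behind single coordinates:
  an observed set is a union of modalities, so it contains all of the modality of j as soon as it
  contains j.
\<close>

lemma modality_of_subset_iff:
  assumes "modalities p K Ob \<L>" "j < p" "k < K"
  shows "modality_of \<L> j \<in> \<L>" "modality_of \<L> j \<subseteq> Ob k \<longleftrightarrow> j \<in> Ob k"
proof -
  have part: "partition_on {..<p} \<L>" and un: "\<exists>\<Q>\<subseteq>\<L>. Ob k = \<Union>\<Q>"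
    using assms by (auto simp: modalities_def is_arg_min_def union_of_parts_def)
  obtain G where G: "G \<in> \<L>" "j \<in> G" using part assms(2) unfolding partition_on_def by blast
  have uniq: "H = G" if "H \<in> \<L>" "j \<in> H" for H
    using part G that unfolding partition_on_def disjoint_def by blast
  have eq: "modality_of \<L> j = G" unfolding modality_of_def using G uniq by (intro the_equality conjI) blast+
  show "modality_of \<L> j \<in> \<L>" using eq G by simp
  show "modality_of \<L> j \<subseteq> Ob k \<longleftrightarrow> j \<in> Ob k"
    unfolding eq using un uniq G(2) by blast
qed

lemma h_count_eq:
  assumes "modalities p K Ob \<L>" "j < p"
  shows "real (h_count K Ob n (modality_of \<L> j)) = (\<Sum>i\<in>lab_idx K n. of_bool (j \<in> Ob (fst i)))"
  unfolding h_count_def sum_lab_idx[of "\<lambda>k. of_bool (j \<in> Ob k)"] of_nat_sum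
  using modality_of_subset_iff(2)[OF assms] by (intro sum.cong) auto

lemma pair_count_eq:
  assumes "modalities p K Ob \<L>" "j < p" "l < p"
  shows "real (pair_count K Ob n (modality_of \<L> j) (modality_of \<L> l))
    = (\<Sum>i\<in>lab_idx K n. of_bool ({j, l} \<subseteq> Ob (fst i)))"
  unfolding pair_count_def sum_lab_idx[of "\<lambda>k. of_bool ({j, l} \<subseteq> Ob k)"] of_nat_sum
  using modality_of_subset_iff(2)[OF assms(1)] assms(2,3) by (intro sum.cong) auto

section \<open>The regression model\<close>

locale sub_gaussian_regression =
  fixes p :: nat and P :: "((nat \<Rightarrow> real) \<times> real) measure" and \<beta> :: "nat \<Rightarrow> real" and \<sigma> R :: real
  assumes model: "linear_model p P \<beta> \<sigma>"
    and R_pos: "R > 0"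
    and psi2_X: "psi2_norm_vec p P fst \<le> ennreal R"
    and sub_gaussian_noise: "sub_gaussian P (noise p \<beta>) \<sigma>"
begin

text \<open>
  An upper bound, up to a constant, for the sub-Gaussian norm of Y.
\<close>

definition scale_Y :: real where "scale_Y = \<sigma> + R * L2_set \<beta> {..<p}"

sublocale prob_space P
  using model by (simp add: linear_model_def)

lemma sets_P: "sets P = sets (RN p \<Otimes>\<^sub>M borel)"
  using model by (simp add: linear_model_def)

lemma sigma_nonneg: "\<sigma> \<ge> 0" using model by (simp add: linear_model_def)

lemma scale_Y_nonneg: "scale_Y \<ge> 0" using sigma_nonneg R_pos by (simp add: scale_Y_def)

lemma measurable_P[measurable]: "fst \<in> measurable P (RN p)" "snd \<in> borel_measurable P"
  by (rule measurable_fst_P[OF sets_P])+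

lemma measurable_X[measurable]: "j < p \<Longrightarrow> (\<lambda>w. fst w j) \<in> borel_measurable P"
  using measurable_compose[OF measurable_P(1) measurable_component_singleton[of j "{..<p}" "\<lambda>_. borel"]] by simp

lemma measurable_inner[measurable]: "(\<lambda>w. inner_p p u (fst w)) \<in> borel_measurable P"
  unfolding inner_p_def by (intro borel_measurable_sum borel_measurable_times measurable_X borel_measurable_const) auto

lemma Y_eq: "snd w = inner_p p \<beta> (fst w) + noise p \<beta> w"
  by (simp add: noise_def split_def inner_p_def mult.commute)

lemma measurable_noise[measurable]: "noise p \<beta> \<in> borel_measurable P"
proof -
  have "noise p \<beta> = (\<lambda>w. snd w - inner_p p \<beta> (fst w))" by (simp add: Y_eq)
  then show ?thesis by simp
qed

lemma integrable_product_of_squares: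
  assumes "integrable P (\<lambda>w. (f w)\<^sup>2)" "integrable P (\<lambda>w. (g w)\<^sup>2)"
    and [measurable]: "f \<in> borel_measurable P" "g \<in> borel_measurable P"
  shows "integrable P (\<lambda>w. f w * g w :: real)"
proof (rule Bochner_Integration.integrable_bound[of P "\<lambda>w. (f w)\<^sup>2 + (g w)\<^sup>2"])
  have "\<bar>x * y\<bar> \<le> x\<^sup>2 + y\<^sup>2" for x y :: real
  proof -
    have "2 * \<bar>x * y\<bar> \<le> x\<^sup>2 + y\<^sup>2"
      using sum_squares_bound[of "\<bar>x\<bar>" "\<bar>y\<bar>"] by (simp add: abs_mult mult.assoc)
    then show ?thesis using abs_ge_zero[of "x * y"] by linarith
  qed
  then show "AE w in P. norm (f w * g w) \<le> norm ((f w)\<^sup>2 + (g w)\<^sup>2)" by auto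
qed (use assms in auto)

lemma integrable_XX: "i < p \<Longrightarrow> j < p \<Longrightarrow> integrable P (\<lambda>w. fst w i * fst w j)"
  using model by (intro integrable_product_of_squares measurable_X) (simp_all add: linear_model_def)

lemma integrable_X_noise: "j < p \<Longrightarrow> integrable P (\<lambda>w. fst w j * noise p \<beta> w)"
  using model by (intro integrable_product_of_squares measurable_X measurable_noise) (simp_all add: linear_model_def)

text \<open>
  The variable \<open>X\<^sub>j\<close> is measurable with respect to X, so it can be moved into the conditional
  expectation of the noise given X.
\<close>

lemma expectation_X_noise:
  assumes j: "j < p"
  shows "(\<integral>w. fst w j * noise p \<beta> w \<partial>P) = 0"
proof -
  have sub: "subalgebra P (sigma_X p P)"
    unfolding subalgebra_def sigma_X_def
    by (intro conjI space_vimage_algebra sets_image_in_sets refl measurable_P)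
  interpret S: finite_measure_subalgebra P "sigma_X p P" by unfold_locales (rule sub)
  have [measurable]: "(\<lambda>w. fst w j) \<in> borel_measurable (sigma_X p P)"
  proof -
    have "fst \<in> measurable (sigma_X p P) (RN p)"
      unfolding sigma_X_def by (intro measurable_vimage_algebra1) (use measurable_space[OF measurable_P(1)] in auto)
    from measurable_compose[OF this measurable_component_singleton[of j "{..<p}" "\<lambda>_. borel"]]
    show ?thesis using j by simp
  qed
  have "(\<integral>w. fst w j * noise p \<beta> w \<partial>P) = (\<integral>w. fst w j * real_cond_exp P (sigma_X p P) (noise p \<beta>) w \<partial>P)"
    using integrable_X_noise[OF j] by (intro S.real_cond_exp_intg(2)[symmetric]) auto
  also have "\<dots> = (\<integral>w. 0 \<partial>P)"
    using model j by (intro integral_cong_AE) (auto simp: linear_model_def)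
  finally show ?thesis by simp
qed

lemma expectation_X_inner:
  assumes j: "j < p"
  shows "integrable P (\<lambda>w. fst w j * inner_p p u (fst w))"
    "(\<integral>w. fst w j * inner_p p u (fst w) \<partial>P) = mat_vec p (Sigma_X P) u j"
proof -
  have e: "fst w j * inner_p p u (fst w) = (\<Sum>l<p. u l * (fst w j * fst w l))" for w :: "(nat \<Rightarrow> real) \<times> real"
    by (simp add: inner_p_def sum_distrib_left mult_ac)
  show "integrable P (\<lambda>w. fst w j * inner_p p u (fst w))"
    unfolding e using integrable_XX[OF j] by auto
  show "(\<integral>w. fst w j * inner_p p u (fst w) \<partial>P) = mat_vec p (Sigma_X P) u j"
    unfolding e mat_vec_def Sigma_X_def using integrable_XX[OF j]
    by (subst Bochner_Integration.integral_sum) (auto simp: mult.commute)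
qed

lemma expectation_XY:
  assumes j: "j < p"
  shows "(\<integral>w. fst w j * snd w \<partial>P) = mat_vec p (Sigma_X P) \<beta> j"
  unfolding Y_eq distrib_left
  using expectation_X_inner[OF j] integrable_X_noise[OF j] expectation_X_noise[OF j] by simp

lemma exp_square_moment_X:
  assumes "c > 0" "2 * R * L2_set u {..<p} \<le> c"
  shows "(\<integral>\<^sup>+ w. ennreal (exp ((inner_p p u (fst w))\<^sup>2 / c\<^sup>2)) \<partial>P) \<le> 2"
  using prob_space_axioms psi2_X R_pos assms by (rule exp_square_moment_inner)

lemma inner_p_unit: "j < p \<Longrightarrow> inner_p p (\<lambda>l. of_bool (l = j)) x = x j"
  by (simp add: inner_p_def)

lemma L2_set_unit: "j < p \<Longrightarrow> L2_set (\<lambda>l. of_bool (l = j)) {..<p} = 1"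
  by (simp add: L2_set_def power2_eq_square)

lemma exp_square_moment_X_component:
  assumes "j < p"
  shows "(\<integral>\<^sup>+ w. ennreal (exp ((fst w j)\<^sup>2 / (2 * R)\<^sup>2)) \<partial>P) \<le> 2"
  using exp_square_moment_X[of "2 * R" "\<lambda>l. of_bool (l = j)"] R_pos assms
  by (simp add: inner_p_unit L2_set_unit)

text \<open>
  Both factors have Gaussian tails, with scales \<open>2 R\<close> and \<open>2 R |u|\<close>. The bounds stay valid for
  \<open>u = 0\<close>, which occurs when an observation misses the coordinate in question.
\<close>

lemma sub_exponential_X_inner:
  assumes j: "j < p"
  shows "sub_exponential P (\<lambda>w. fst w j * inner_p p u (fst w)) (mat_vec p (Sigma_X P) u j)
    (16 * R ^ 4 * (L2_set u {..<p})\<^sup>2) (4 * R\<^sup>2 * L2_set u {..<p})"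
proof (cases "L2_set u {..<p} = 0")
  case True
  then have "inner_p p u x = 0" for x by (auto simp: inner_p_def L2_set_eq_0_iff)
  moreover have "mat_vec p (Sigma_X P) u j = 0" using True by (auto simp: mat_vec_def L2_set_eq_0_iff)
  ultimately show ?thesis using True sub_exponential_AE_zero[of P "\<lambda>_. 0" 0] prob_space_axioms by simp
next
  case False
  define r where "r = L2_set u {..<p}"
  have r: "r > 0" using False L2_set_nonneg[of u "{..<p}"] by (auto simp: r_def less_le)
  have "(\<integral>\<^sup>+ w. ennreal (exp (\<bar>fst w j * inner_p p u (fst w)\<bar> / ((2 * R) * (2 * R * r)))) \<partial>P) \<le> 2"
    using j R_pos r
    by (intro exp_moment_product exp_square_moment_X_component exp_square_moment_X) (auto simp: r_def)
  then have "sub_exponential P (\<lambda>w. fst w j * inner_p p u (fst w))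
      (\<integral>w. fst w j * inner_p p u (fst w) \<partial>P) (((2 * R) * (2 * R * r))\<^sup>2) ((2 * R) * (2 * R * r))"
    using j R_pos r by (intro sub_exponential_of_exp_moment prob_space_axioms) auto
  moreover have "((2 * R) * (2 * R * r))\<^sup>2 = 16 * R ^ 4 * r\<^sup>2" "(2 * R) * (2 * R * r) = 4 * R\<^sup>2 * r"
    by (simp_all add: power2_eq_square power4_eq_xxxx)
  ultimately show ?thesis by (simp only: expectation_X_inner(2)[OF j] r_def)
qed

lemma exp_square_moment_Y:
  assumes scale_Y: "scale_Y > 0"
  shows "(\<integral>\<^sup>+ w. ennreal (exp ((snd w)\<^sup>2 / (6 * scale_Y)\<^sup>2)) \<partial>P) \<le> 2"
proof (rule exp_moment_average)
  have b: "0 \<le> R * L2_set \<beta> {..<p}" using R_pos by simp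
  show "(\<integral>\<^sup>+ w. ennreal (exp ((inner_p p \<beta> (fst w))\<^sup>2 / (3 * scale_Y)\<^sup>2)) \<partial>P) \<le> 2"
  proof (rule exp_square_moment_X)
    show "2 * R * L2_set \<beta> {..<p} \<le> 3 * scale_Y"
      using sigma_nonneg b unfolding scale_Y_def mult.assoc[of 2] distrib_left by linarith
  qed (use scale_Y in simp)
  have "\<sigma>\<^sup>2 \<le> scale_Y\<^sup>2" using sigma_nonneg b by (intro power_mono) (auto simp: scale_Y_def)
  then have "6 * \<sigma>\<^sup>2 \<le> 9 * scale_Y\<^sup>2" using zero_le_power2[of \<sigma>] by linarith
  then have "6 * \<sigma>\<^sup>2 \<le> (3 * scale_Y)\<^sup>2" by (simp add: power_mult_distrib)
  moreover have "3 * scale_Y > 0" using scale_Y by linarith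
  ultimately show "(\<integral>\<^sup>+ w. ennreal (exp ((noise p \<beta> w)\<^sup>2 / (3 * scale_Y)\<^sup>2)) \<partial>P) \<le> 2"
    by (intro exp_square_moment_of_sub_gaussian[OF measurable_noise prob_space_axioms sub_gaussian_noise])
  show "(snd w)\<^sup>2 / (6 * scale_Y)\<^sup>2 \<le> ((inner_p p \<beta> (fst w))\<^sup>2 / (3 * scale_Y)\<^sup>2 + (noise p \<beta> w)\<^sup>2 / (3 * scale_Y)\<^sup>2) / 2" for w
  proof -
    have "(a + b)\<^sup>2 / (6 * scale_Y)\<^sup>2 \<le> (a\<^sup>2 / (3 * scale_Y)\<^sup>2 + b\<^sup>2 / (3 * scale_Y)\<^sup>2) / 2" for a b :: real
    proof -
      have "(a + b)\<^sup>2 \<le> 2 * a\<^sup>2 + 2 * b\<^sup>2" using sum_squares_bound[of a b] by (simp add: power2_sum)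
      then have "(a + b)\<^sup>2 / (6 * scale_Y)\<^sup>2 \<le> (2 * a\<^sup>2 + 2 * b\<^sup>2) / (6 * scale_Y)\<^sup>2" by (rule divide_right_mono) simp
      also have "\<dots> = (a\<^sup>2 / (3 * scale_Y)\<^sup>2 + b\<^sup>2 / (3 * scale_Y)\<^sup>2) / 2"
        by (simp add: power_mult_distrib add_divide_distrib)
      finally show ?thesis .
    qed
    then show ?thesis unfolding Y_eq .
  qed
qed auto

text \<open>
  If the scale of Y vanishes then so do the noise and the signal, and Y is almost surely 0.
  Otherwise X has scale \<open>2 R\<close> and Y has scale 6 times \<open>scale_Y\<close>.
\<close>

lemma sub_exponential_XY:
  assumes j: "j < p"
  shows "sub_exponential P (\<lambda>w. fst w j * snd w) (mat_vec p (Sigma_X P) \<beta> j) ((12 * R * scale_Y)\<^sup>2) (12 * R * scale_Y)"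
proof (cases "scale_Y = 0")
  case True
  have "0 \<le> R * L2_set \<beta> {..<p}" using R_pos by simp
  then have 0: "\<sigma> = 0" "L2_set \<beta> {..<p} = 0" using True sigma_nonneg R_pos
    by (simp_all add: scale_Y_def add_nonneg_eq_0_iff)
  have "sub_exponential P (noise p \<beta>) 0 0 0"
    using sub_gaussian_noise 0 unfolding sub_gaussian_def sub_exponential_def by auto
  then have "AE w in P. noise p \<beta> w = 0" by (rule sub_exponential_0_AE[OF prob_space_axioms])
  moreover have z: "inner_p p \<beta> x = 0" for x using 0 by (auto simp: inner_p_def L2_set_eq_0_iff)
  ultimately have "AE w in P. fst w j * snd w = 0" by (auto simp: Y_eq)
  moreover have "mat_vec p (Sigma_X P) \<beta> j = 0" using 0 by (auto simp: mat_vec_def L2_set_eq_0_iff)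
  ultimately show ?thesis unfolding True
    using sub_exponential_AE_zero[of P "\<lambda>w. fst w j * snd w" 0] prob_space_axioms j by simp
next
  case False
  then have scale_Y: "scale_Y > 0" using scale_Y_nonneg by simp
  have "(\<integral>\<^sup>+ w. ennreal (exp (\<bar>fst w j * snd w\<bar> / ((2 * R) * (6 * scale_Y)))) \<partial>P) \<le> 2"
    using j R_pos scale_Y by (intro exp_moment_product exp_square_moment_X_component exp_square_moment_Y) auto
  then have "sub_exponential P (\<lambda>w. fst w j * snd w)
      (\<integral>w. fst w j * snd w \<partial>P) (((2 * R) * (6 * scale_Y))\<^sup>2) ((2 * R) * (6 * scale_Y))"
    using j R_pos scale_Y by (intro sub_exponential_of_exp_moment prob_space_axioms) auto
  moreover have "(2 * R) * (6 * scale_Y) = 12 * R * scale_Y" by simp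
  ultimately show ?thesis by (simp only: expectation_XY[OF j])
qed

end

section \<open>Concentration of the sample moments\<close>

context sub_gaussian_regression begin

lemma gamma_hat_sub_exponential:
  assumes Ob: "\<forall>k<K. Ob k \<subseteq> {..<p}" and \<L>: "modalities p K Ob \<L>" and j: "j < p"
    and h: "h = real (h_count K Ob n (modality_of \<L> j))" "h > 0"
  shows "sub_exponential (data_law p K Ob n N P) (\<lambda>D. gamma_hat K Ob n \<L> D j)
    (mat_vec p (Sigma_X P) \<beta> j) ((12 * R * scale_Y)\<^sup>2 / h) (12 * R * scale_Y / h)"
proof -
  define F :: "nat \<times> nat \<Rightarrow> (nat \<Rightarrow> real) \<times> real \<Rightarrow> real"
    where "F i = (\<lambda>(x, y). if j \<in> Ob (fst i) then 1 / h * (x j * y) else 0)" for i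
  let ?\<gamma> = "mat_vec p (Sigma_X P) \<beta> j"
  let ?o = "\<lambda>i :: nat \<times> nat. of_bool (j \<in> Ob (fst i)) :: real"
  have b0: "0 \<le> 12 * R * scale_Y / h" using R_pos scale_Y_nonneg h(2) by (intro divide_nonneg_pos mult_nonneg_nonneg) auto
  have "sub_exponential (data_law p K Ob n N P)
      (\<lambda>(lab, unl). (\<Sum>i\<in>lab_idx K n. F i (lab i)) + (\<Sum>k<N. 0))
      ((\<Sum>i\<in>lab_idx K n. ?o i * (1 / h * ?\<gamma>)) + real N * 0)
      ((\<Sum>i\<in>lab_idx K n. ?o i * ((1 / h)\<^sup>2 * (12 * R * scale_Y)\<^sup>2)) + real N * 0) (12 * R * scale_Y / h)"
  proof (rule sub_exponential_data_sum[OF prob_space_axioms sets_P Ob])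
    show "sub_exponential P (\<lambda>w. (0::real)) 0 0 (12 * R * scale_Y / h)"
      by (intro sub_exponential_AE_zero prob_space_axioms) auto
    fix i assume i: "i \<in> lab_idx K n"
    show "F i \<in> borel_measurable (PiM (Ob (fst i)) (\<lambda>_. borel) \<Otimes>\<^sub>M borel)"
    proof (cases "j \<in> Ob (fst i)")
      case True
      have "(\<lambda>w. fst w j) \<in> borel_measurable (PiM (Ob (fst i)) (\<lambda>_. borel) \<Otimes>\<^sub>M (borel :: real measure))"
        using measurable_compose[OF measurable_fst measurable_component_singleton[OF True]] .
      then show ?thesis using True
        by (auto simp: F_def split_def intro!: borel_measurable_times borel_measurable_divide borel_measurable_const measurable_snd)
    qed (simp add: F_def)
    show "sub_exponential P (\<lambda>(x, y). F i (restrict x (Ob (fst i)), y)) (?o i * (1 / h * ?\<gamma>))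
        (?o i * ((1 / h)\<^sup>2 * (12 * R * scale_Y)\<^sup>2)) (12 * R * scale_Y / h)"
    proof (cases "j \<in> Ob (fst i)")
      case True
      have "sub_exponential P (\<lambda>w. 1 / h * (fst w j * snd w)) (1 / h * ?\<gamma>)
          ((1 / h)\<^sup>2 * (12 * R * scale_Y)\<^sup>2) (\<bar>1 / h\<bar> * (12 * R * scale_Y))"
        by (rule sub_exponential_scale[OF sub_exponential_XY[OF j]])
      then show ?thesis using True h(2) by (simp add: F_def split_def)
    next
      case False
      then show ?thesis
        using sub_exponential_AE_zero[OF prob_space_axioms, of "\<lambda>_. 0"] by (simp add: F_def split_def)
    qed
  qed auto
  moreover have "(\<lambda>(lab, unl :: nat \<Rightarrow> nat \<Rightarrow> real). (\<Sum>i\<in>lab_idx K n. F i (lab i)) + (\<Sum>k<N. 0)) = (\<lambda>D. gamma_hat K Ob n \<L> D j)"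
  proof (intro ext, clarify)
    fix lab :: "nat \<times> nat \<Rightarrow> (nat \<Rightarrow> real) \<times> real" and unl :: "nat \<Rightarrow> nat \<Rightarrow> real"
    have "(\<Sum>i\<in>lab_idx K n. F i (lab i)) = gamma_hat K Ob n \<L> (lab, unl) j"
      unfolding gamma_hat_def split_conv h(1)[symmetric] sum_distrib_left F_def split_def
      by (rule sum.cong[OF refl]) simp
    then show "(\<Sum>i\<in>lab_idx K n. F i (lab i)) + (\<Sum>k<N. 0) = gamma_hat K Ob n \<L> (lab, unl) j" by simp
  qed
  moreover have "(\<Sum>i\<in>lab_idx K n. ?o i * (1 / h * ?\<gamma>)) + real N * 0 = ?\<gamma>"
    unfolding sum_distrib_right[symmetric] h_count_eq[OF \<L> j, of n, folded h(1), symmetric]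
    using h(2) by simp
  moreover have "(\<Sum>i\<in>lab_idx K n. ?o i * ((1 / h)\<^sup>2 * (12 * R * scale_Y)\<^sup>2)) + real N * 0 = (12 * R * scale_Y)\<^sup>2 / h"
    unfolding sum_distrib_right[symmetric] h_count_eq[OF \<L> j, of n, folded h(1), symmetric]
    using h(2) by (simp add: power2_eq_square)
  ultimately show ?thesis by (simp only:)
qed

text \<open>
  The choice of \<open>\<tau>\<close> makes the quadratic term at most \<open>16 L\<close> and the linear term \<open>T L / 12\<close>, which is
  at least \<open>19 L\<close> for \<open>T \<ge> 228 = 12 * 19\<close>. The condition \<open>4 L \<le> h\<^sub>0\<close> keeps \<open>\<tau>\<close> in the range
  where the moment generating function is controlled.
\<close>

lemma gamma_hat_tail:
  assumes Ob: "\<forall>k<K. Ob k \<subseteq> {..<p}" and \<L>: "modalities p K Ob \<L>" and j: "j < p"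
    and h0: "h\<^sub>0 \<le> real (h_count K Ob n (modality_of \<L> j))" "h\<^sub>0 > 0" and L: "0 \<le> L" "4 * L \<le> h\<^sub>0" and T: "T \<ge> 228"
  shows "measure (data_law p K Ob n N P) {D \<in> space (data_law p K Ob n N P).
      \<bar>gamma_hat K Ob n \<L> D j - mat_vec p (Sigma_X P) \<beta> j\<bar> > T * (R * scale_Y) * sqrt (L / h\<^sub>0)} \<le> 2 * exp (- 3 * L)"
    (is "measure ?D ?bad \<le> _")
proof -
  note D = data_law_parts(5)[OF prob_space_axioms sets_P Ob, of n N]
  define h where "h = real (h_count K Ob n (modality_of \<L> j))"
  have h: "h\<^sub>0 \<le> h" "h > 0" using h0 by (auto simp: h_def)
  note se = gamma_hat_sub_exponential[OF Ob \<L> j h_def h(2), of N]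
  define v where "v = scale_Y"
  show ?thesis
  proof (cases "v = 0")
    case True
    \<comment> \<open>then the scale and the variance proxy are 0, and \<open>gamma_hat\<close> has no deviation at all\<close>
    then have "AE D in ?D. gamma_hat K Ob n \<L> D j = mat_vec p (Sigma_X P) \<beta> j"
      using se unfolding v_def[symmetric] by (intro sub_exponential_0_AE D) simp
    then have "AE D in ?D. D \<notin> ?bad" using True unfolding v_def by auto
    moreover have "?bad \<in> sets ?D"
    proof -
      have [measurable]: "(\<lambda>D. gamma_hat K Ob n \<L> D j) \<in> borel_measurable ?D"
        using se by (simp add: sub_exponential_def)
      show ?thesis by measurable
    qed
    ultimately have "measure ?D ?bad = 0" by (subst measure_eq_0_null_sets) (auto simp: AE_iff_null_sets)
    then show ?thesis by simp
  next
    case False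
    then have v: "v > 0" using scale_Y_nonneg by (simp add: v_def)
    define b where "b = 12 * R * v"
    have b: "b > 0" using v R_pos by (simp add: b_def)
    define \<tau> where "\<tau> = sqrt (L * h\<^sub>0) / b"
    have sq: "sqrt (L * h\<^sub>0) = h\<^sub>0 * sqrt (L / h\<^sub>0)" "sqrt (L / h\<^sub>0) \<ge> 0"
      using h0(2) L by (simp_all add: real_sqrt_mult real_sqrt_divide real_div_sqrt field_simps)
    have "sqrt (L / h\<^sub>0) \<le> sqrt (1 / 4)" using L h0(2) by (intro real_sqrt_le_mono) (simp add: field_simps)
    then have sq_half: "sqrt (L / h\<^sub>0) \<le> 1 / 2" by (simp add: real_sqrt_divide)
    have \<tau>0: "\<tau> \<ge> 0" using b h0(2) L by (simp add: \<tau>_def)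
    have "\<tau> * (b / h) = (h\<^sub>0 / h) * sqrt (L / h\<^sub>0)" using b sq by (simp add: \<tau>_def)
    also have "\<dots> \<le> 1 * (1 / 2)" using h h0(2) sq sq_half by (intro mult_mono) auto
    finally have \<tau>b: "\<tau> * (b / h) \<le> 1 / 2" by simp
    have "measure ?D ?bad \<le> 2 * exp (16 * \<tau>\<^sup>2 * (b\<^sup>2 / h) - \<tau> * (T * (R * scale_Y) * sqrt (L / h\<^sub>0)))"
      using sub_exponential_tail[OF D se \<tau>0] \<tau>b unfolding b_def v_def by simp
    also have "16 * \<tau>\<^sup>2 * (b\<^sup>2 / h) - \<tau> * (T * (R * scale_Y) * sqrt (L / h\<^sub>0)) \<le> 16 * L - T / 12 * L"
    proof -
      have "\<tau>\<^sup>2 * (b\<^sup>2 / h) = L * (h\<^sub>0 / h)" using b h0(2) L by (simp add: \<tau>_def power_divide)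
      also have "\<dots> \<le> L * 1" using h h0 L by (intro mult_left_mono) auto
      finally have 1: "16 * (\<tau>\<^sup>2 * (b\<^sup>2 / h)) \<le> 16 * L" by simp
      have "\<tau> * (T * (R * v) * sqrt (L / h\<^sub>0)) = T * (R * v) / b * (sqrt (L * h\<^sub>0) * sqrt (L / h\<^sub>0))" by (simp add: \<tau>_def)
      also have "sqrt (L * h\<^sub>0) * sqrt (L / h\<^sub>0) = L" using h0(2) L by (simp flip: real_sqrt_mult)
      also have "T * (R * v) / b = T / 12" using v R_pos by (simp add: b_def)
      finally have 2: "\<tau> * (T * (R * v) * sqrt (L / h\<^sub>0)) = T / 12 * L" .
      show ?thesis using 1 unfolding v_def[symmetric] 2 mult.assoc[of 16 "\<tau>\<^sup>2"] by linarith
    qed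
    also have "16 * L - T / 12 * L = (16 - T / 12) * L" by (simp add: algebra_simps)
    also have "\<dots> \<le> (- 3) * L" using T L by (intro mult_right_mono) auto
    finally show ?thesis by simp
  qed
qed

text \<open>
  An observation with pattern k contributes \<open>X\<^sub>j\<close> times the inner product of X with \<open>u k\<close>, the
  vector of the \<open>v l / c l\<close> over those l for which j and l are both observed; an unlabelled
  observation contributes the same with all coordinates present. The number of observations that
  see j and l is exactly \<open>c l\<close>, so the sum of the squared norms of these vectors is the sum of
  \<open>(v l)\<^sup>2 / c l\<close>.
\<close>

lemma Sigma_hat_sub_exponential:
  assumes Ob: "\<forall>k<K. Ob k \<subseteq> {..<p}" and \<L>: "modalities p K Ob \<L>" and j: "j < p"
    and m: "m > 0" "\<And>l. l < p \<Longrightarrow> m \<le> real (pair_count K Ob n (modality_of \<L> j) (modality_of \<L> l)) + real N"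
  shows "sub_exponential (data_law p K Ob n N P) (\<lambda>D. mat_vec p (Sigma_hat K Ob n N \<L> D) v j)
    (mat_vec p (Sigma_X P) v j) (16 * R ^ 4 * (L2_set v {..<p})\<^sup>2 / m) (4 * R\<^sup>2 * L2_set v {..<p} / m)"
proof -
  define c where "c l = real (pair_count K Ob n (modality_of \<L> j) (modality_of \<L> l)) + real N" for l
  have c: "m \<le> c l" "c l > 0" if "l < p" for l using m(1) m(2)[OF that] by (auto simp: c_def)
  define a where "a l = v l / c l" for l
  define u where "u k l = of_bool ({j, l} \<subseteq> Ob k) * a l" for k l
  define F :: "nat \<times> nat \<Rightarrow> (nat \<Rightarrow> real) \<times> real \<Rightarrow> real"
    where "F i = (\<lambda>(x, y). \<Sum>l<p. if {j, l} \<subseteq> Ob (fst i) then x j * (a l * x l) else 0)" for i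
  define G :: "(nat \<Rightarrow> real) \<Rightarrow> real" where "G x = x j * inner_p p a x" for x
  let ?b = "4 * R\<^sup>2 * L2_set v {..<p} / m"
  have sumsq: "(L2_set x {..<p})\<^sup>2 = (\<Sum>l<p. (x l)\<^sup>2)" for x by (simp add: L2_set_def sum_nonneg)
  have a_le: "L2_set a {..<p} \<le> L2_set v {..<p} / m"
  proof -
    have "\<bar>a l\<bar> \<le> (1 / m) * \<bar>v l\<bar>" if "l < p" for l
      using c[OF that] m(1) by (auto simp: a_def abs_divide intro!: divide_left_mono mult_pos_pos)
    then have "L2_set (\<lambda>l. \<bar>a l\<bar>) {..<p} \<le> L2_set (\<lambda>l. (1 / m) * \<bar>v l\<bar>) {..<p}" by (intro L2_set_mono) auto
    also have "\<dots> = (1 / m) * L2_set (\<lambda>l. \<bar>v l\<bar>) {..<p}" using m(1) by (intro L2_set_right_distrib[symmetric]) simp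
    finally show ?thesis by (simp add: L2_set_def)
  qed
  have u_le: "L2_set (u k) {..<p} \<le> L2_set a {..<p}" for k
    unfolding L2_set_def u_def by (intro real_sqrt_le_mono sum_mono) auto
  have se: "sub_exponential P (\<lambda>w. fst w j * inner_p p x (fst w)) (mat_vec p (Sigma_X P) x j)
      (16 * R ^ 4 * (L2_set x {..<p})\<^sup>2) ?b" if "L2_set x {..<p} \<le> L2_set a {..<p}" for x
  proof (rule sub_exponential_mono[OF sub_exponential_X_inner[OF j, of x] order_refl])
    have "4 * R\<^sup>2 * L2_set x {..<p} \<le> 4 * R\<^sup>2 * (L2_set v {..<p} / m)"
      using that a_le by (intro mult_left_mono) auto
    then show "4 * R\<^sup>2 * L2_set x {..<p} \<le> ?b" by simp
  qed
  have S: "sub_exponential (data_law p K Ob n N P)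
      (\<lambda>(lab, unl). (\<Sum>i\<in>lab_idx K n. F i (lab i)) + (\<Sum>k<N. G (unl k)))
      ((\<Sum>i\<in>lab_idx K n. mat_vec p (Sigma_X P) (u (fst i)) j) + real N * mat_vec p (Sigma_X P) a j)
      ((\<Sum>i\<in>lab_idx K n. 16 * R ^ 4 * (L2_set (u (fst i)) {..<p})\<^sup>2) + real N * (16 * R ^ 4 * (L2_set a {..<p})\<^sup>2)) ?b"
  proof (rule sub_exponential_data_sum[OF prob_space_axioms sets_P Ob])
    show "G \<in> borel_measurable (RN p)" unfolding G_def inner_p_def using j
      by (intro borel_measurable_times borel_measurable_sum borel_measurable_const measurable_component_singleton) auto
    show "sub_exponential P (\<lambda>w. G (fst w)) (mat_vec p (Sigma_X P) a j) (16 * R ^ 4 * (L2_set a {..<p})\<^sup>2) ?b"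
      unfolding G_def by (rule se) simp
    fix i assume i: "i \<in> lab_idx K n"
    have comp: "(\<lambda>w. fst w l) \<in> borel_measurable (PiM (Ob (fst i)) (\<lambda>_. borel) \<Otimes>\<^sub>M (borel :: real measure))"
      if "l \<in> Ob (fst i)" for l
      using measurable_compose[OF measurable_fst measurable_component_singleton[OF that]] .
    show "F i \<in> borel_measurable (PiM (Ob (fst i)) (\<lambda>_. borel) \<Otimes>\<^sub>M borel)"
      unfolding F_def split_def
    proof (intro borel_measurable_sum)
      fix l
      show "(\<lambda>w. if {j, l} \<subseteq> Ob (fst i) then fst w j * (a l * fst w l) else 0)
          \<in> borel_measurable (PiM (Ob (fst i)) (\<lambda>_. borel) \<Otimes>\<^sub>M (borel :: real measure))"
        by (cases "{j, l} \<subseteq> Ob (fst i)") (auto intro!: borel_measurable_times comp)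
    qed
    have "(\<lambda>(x, y). F i (restrict x (Ob (fst i)), y)) = (\<lambda>w. fst w j * inner_p p (u (fst i)) (fst w))"
      unfolding F_def u_def inner_p_def by (auto simp: fun_eq_iff sum_distrib_left intro!: sum.cong)
    then show "sub_exponential P (\<lambda>(x, y). F i (restrict x (Ob (fst i)), y)) (mat_vec p (Sigma_X P) (u (fst i)) j)
        (16 * R ^ 4 * (L2_set (u (fst i)) {..<p})\<^sup>2) ?b"
      using se[OF u_le] by simp
  qed
  have E1: "(\<lambda>(lab, unl). (\<Sum>i\<in>lab_idx K n. F i (lab i)) + (\<Sum>k<N. G (unl k))) = (\<lambda>D. mat_vec p (Sigma_hat K Ob n N \<L> D) v j)"
  proof (intro ext, clarify)
    fix lab :: "nat \<times> nat \<Rightarrow> (nat \<Rightarrow> real) \<times> real" and unl :: "nat \<Rightarrow> nat \<Rightarrow> real"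
    have "(\<Sum>i\<in>lab_idx K n. F i (lab i)) + (\<Sum>k<N. G (unl k))
      = (\<Sum>i\<in>lab_idx K n. \<Sum>l<p. a l * (fst (lab i) j * fst (lab i) l * of_bool ({j, l} \<subseteq> Ob (fst i))))
        + (\<Sum>k<N. \<Sum>l<p. a l * (unl k j * unl k l))"
      unfolding F_def G_def inner_p_def split_def
      by (intro arg_cong2[of _ _ _ _ "(+)"] sum.cong) (auto simp: sum_distrib_left mult_ac intro!: sum.cong)
    also have "\<dots> = (\<Sum>l<p. a l * ((\<Sum>k<N. unl k j * unl k l) + (\<Sum>i\<in>lab_idx K n. fst (lab i) j * fst (lab i) l * of_bool ({j, l} \<subseteq> Ob (fst i)))))"
      unfolding sum.swap[of _ "{..<p}"] by (simp only: sum_distrib_left distrib_left sum.distrib add.commute)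
    finally show "(\<Sum>i\<in>lab_idx K n. F i (lab i)) + (\<Sum>k<N. G (unl k)) = mat_vec p (Sigma_hat K Ob n N \<L> (lab, unl)) v j"
      unfolding mat_vec_def Sigma_hat_def split_conv c_def[symmetric] a_def by (simp add: c_def mult_ac)
  qed
  have count: "(\<Sum>i\<in>lab_idx K n. of_bool ({j, l} \<subseteq> Ob (fst i))) + real N = c l" if "l < p" for l
    unfolding c_def pair_count_eq[OF \<L> j that] ..
  have "(\<Sum>i\<in>lab_idx K n. mat_vec p (Sigma_X P) (u (fst i)) j) + real N * mat_vec p (Sigma_X P) a j
      = (\<Sum>l<p. Sigma_X P j l * a l * ((\<Sum>i\<in>lab_idx K n. of_bool ({j, l} \<subseteq> Ob (fst i))) + real N))"
    unfolding mat_vec_def u_def sum.swap[of _ "{..<p}"] 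
    by (simp only: sum_distrib_left distrib_left sum.distrib mult_ac)
  also have "\<dots> = (\<Sum>l<p. Sigma_X P j l * v l)"
    using c by (intro sum.cong refl) (simp only: count lessThan_iff, simp add: a_def less_imp_neq[symmetric])
  finally have E2: "(\<Sum>i\<in>lab_idx K n. mat_vec p (Sigma_X P) (u (fst i)) j) + real N * mat_vec p (Sigma_X P) a j
      = mat_vec p (Sigma_X P) v j" unfolding mat_vec_def[of p "Sigma_X P" v] .
  have E3: "(\<Sum>i\<in>lab_idx K n. 16 * R ^ 4 * (L2_set (u (fst i)) {..<p})\<^sup>2) + real N * (16 * R ^ 4 * (L2_set a {..<p})\<^sup>2)
      \<le> 16 * R ^ 4 * (L2_set v {..<p})\<^sup>2 / m"
  proof -
    have ob: "(of_bool b :: real)\<^sup>2 = of_bool b" for b by simp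
    have "(\<Sum>i\<in>lab_idx K n. (L2_set (u (fst i)) {..<p})\<^sup>2) + real N * (L2_set a {..<p})\<^sup>2
      = (\<Sum>l<p. (a l)\<^sup>2 * ((\<Sum>i\<in>lab_idx K n. of_bool ({j, l} \<subseteq> Ob (fst i))) + real N))"
      unfolding sumsq u_def sum.swap[of _ "{..<p}"] power_mult_distrib ob
      by (simp only: sum_distrib_left distrib_left sum.distrib mult_ac)
    also have "\<dots> \<le> (\<Sum>l<p. (v l)\<^sup>2 * (1 / m))"
    proof (intro sum_mono)
      fix l assume "l \<in> {..<p}"
      then have l: "l < p" by simp
      have "(a l)\<^sup>2 * c l = (v l)\<^sup>2 * (1 / c l)" using c[OF l] by (simp add: a_def power2_eq_square)
      also have "\<dots> \<le> (v l)\<^sup>2 * (1 / m)" using c[OF l] m(1) by (intro mult_left_mono divide_left_mono) auto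
      finally show "(a l)\<^sup>2 * ((\<Sum>i\<in>lab_idx K n. of_bool ({j, l} \<subseteq> Ob (fst i))) + real N) \<le> (v l)\<^sup>2 * (1 / m)"
        unfolding count[OF l] .
    qed
    also have "\<dots> = (L2_set v {..<p})\<^sup>2 / m" by (simp add: sumsq sum_divide_distrib)
    finally have "16 * R ^ 4 * ((\<Sum>i\<in>lab_idx K n. (L2_set (u (fst i)) {..<p})\<^sup>2) + real N * (L2_set a {..<p})\<^sup>2)
      \<le> 16 * R ^ 4 * ((L2_set v {..<p})\<^sup>2 / m)" by (rule mult_left_mono) simp
    then show ?thesis by (simp add: sum_distrib_left distrib_left mult_ac)
  qed
  show ?thesis using sub_exponential_mono[OF S E3 order_refl] unfolding E1 E2 .
qed

text \<open>
  As for \<open>gamma_hat\<close>, with linear term \<open>T L / 4\<close> and \<open>76 = 4 * 19\<close>.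
\<close>

lemma Sigma_hat_tail:
  assumes Ob: "\<forall>k<K. Ob k \<subseteq> {..<p}" and \<L>: "modalities p K Ob \<L>" and j: "j < p"
    and m: "m > 0" "\<And>l. l < p \<Longrightarrow> m \<le> real (pair_count K Ob n (modality_of \<L> j) (modality_of \<L> l)) + real N"
    and L: "0 \<le> L" "4 * L \<le> m" and T: "T \<ge> 76"
  shows "measure (data_law p K Ob n N P) {D \<in> space (data_law p K Ob n N P).
      \<bar>mat_vec p (Sigma_hat K Ob n N \<L> D) v j - mat_vec p (Sigma_X P) v j\<bar>
        > T * (R\<^sup>2 * L2_set v {..<p}) * sqrt (L / m)} \<le> 2 * exp (- 3 * L)"
    (is "measure ?D ?bad \<le> _")
proof -
  note D = data_law_parts(5)[OF prob_space_axioms sets_P Ob, of n N]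
  note se = Sigma_hat_sub_exponential[OF Ob \<L> j m, of v]
  show ?thesis
  proof (cases "L2_set v {..<p} = 0")
    case True
    then have "mat_vec p A v j = 0" for A by (simp add: mat_vec_def L2_set_eq_0_iff)
    then show ?thesis using True by simp
  next
    case False
    define r where "r = L2_set v {..<p}"
    have r: "r > 0" using False L2_set_nonneg[of v "{..<p}"] by (auto simp: r_def less_le)
    define b where "b = 4 * R\<^sup>2 * r"
    have b: "b > 0" using r R_pos by (simp add: b_def)
    define \<tau> where "\<tau> = sqrt (L * m) / b"
    have sq: "sqrt (L * m) = m * sqrt (L / m)"
      using m(1) L by (simp_all add: real_sqrt_mult real_sqrt_divide real_div_sqrt field_simps)
    have "sqrt (L / m) \<le> sqrt (1 / 4)" using L m(1) by (intro real_sqrt_le_mono) (simp add: field_simps)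
    then have sq_half: "sqrt (L / m) \<le> 1 / 2" by (simp add: real_sqrt_divide)
    have \<tau>0: "\<tau> \<ge> 0" using b m(1) L by (simp add: \<tau>_def)
    have \<tau>b: "\<tau> * (b / m) \<le> 1 / 2" using b m(1) sq sq_half by (simp add: \<tau>_def)
    have "16 * R ^ 4 * r\<^sup>2 = b\<^sup>2" by (simp add: b_def power2_eq_square power4_eq_xxxx)
    then have "measure ?D ?bad \<le> 2 * exp (16 * \<tau>\<^sup>2 * (b\<^sup>2 / m) - \<tau> * (T * (R\<^sup>2 * r) * sqrt (L / m)))"
      using sub_exponential_tail[OF D se \<tau>0] \<tau>b unfolding b_def r_def by simp
    also have "16 * \<tau>\<^sup>2 * (b\<^sup>2 / m) - \<tau> * (T * (R\<^sup>2 * r) * sqrt (L / m)) = 16 * L - T / 4 * L"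
    proof -
      have 1: "\<tau>\<^sup>2 * (b\<^sup>2 / m) = L" using b m(1) L by (simp add: \<tau>_def power_divide)
      have "\<tau> * (T * (R\<^sup>2 * r) * sqrt (L / m)) = T * (R\<^sup>2 * r) / b * (sqrt (L * m) * sqrt (L / m))" by (simp add: \<tau>_def)
      also have "sqrt (L * m) * sqrt (L / m) = L" using m(1) L by (simp flip: real_sqrt_mult)
      also have "T * (R\<^sup>2 * r) / b = T / 4" using r R_pos by (simp add: b_def)
      finally have 2: "\<tau> * (T * (R\<^sup>2 * r) * sqrt (L / m)) = T / 4 * L" .
      show ?thesis unfolding 2 mult.assoc[of 16 "\<tau>\<^sup>2"] 1 by (rule refl)
    qed
    also have "16 * L - T / 4 * L = (16 - T / 4) * L" by (simp add: algebra_simps)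
    also have "\<dots> \<le> (- 3) * L" using T L by (intro mult_right_mono) auto
    finally show ?thesis by simp
  qed
qed

end

section \<open>The linear program\<close>

lemma linf_norm_le_iff: "p \<ge> 1 \<Longrightarrow> linf_norm p x \<le> c \<longleftrightarrow> (\<forall>j<p. \<bar>x j\<bar> \<le> c)"
  unfolding linf_norm_def by (subst Max_le_iff) (auto simp: lessThan_empty_iff)

lemma compact_box: "compact (Pi\<^sub>E UNIV (\<lambda>j. if j < p then {- B .. B} else {0 :: real}) :: (nat \<Rightarrow> real) set)"
  unfolding compactin_euclidean_iff[symmetric] euclidean_product_topology[symmetric] compactin_PiE
  by (auto simp: compactin_euclidean_iff)

text \<open>
  Entries of a vector beyond the dimension do not influence the program, so they may be set to 0.
  A vector with no larger \<open>\<ell>\<^sub>1\<close> norm than a given feasible point then lies in a product of compact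
  intervals, and the objective attains its minimum over the closed set of feasible points in it.
\<close>

lemma l1_minimizer_exists:
  assumes p: "p \<ge> 1" and feas: "linf_norm p (\<lambda>j. mat_vec p M b0 j - g j) \<le> lam"
  shows "\<exists>b. is_arg_min (l1_norm_on {..<p}) (\<lambda>b. linf_norm p (\<lambda>j. mat_vec p M b j - g j) \<le> lam) b"
proof -
  define feasible where "feasible b \<longleftrightarrow> linf_norm p (\<lambda>j. mat_vec p M b j - g j) \<le> lam" for b
  define B where "B = l1_norm_on {..<p} b0"
  define trunc :: "(nat \<Rightarrow> real) \<Rightarrow> nat \<Rightarrow> real" where "trunc b = (\<lambda>j. if j < p then b j else 0)" for b
  define T where "T = (Pi\<^sub>E UNIV (\<lambda>j. if j < p then {- B .. B} else {0}) :: (nat \<Rightarrow> real) set) \<inter> Collect feasible"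
  have trunc: "l1_norm_on {..<p} (trunc b) = l1_norm_on {..<p} b" "feasible (trunc b) = feasible b" for b
  proof -
    show "l1_norm_on {..<p} (trunc b) = l1_norm_on {..<p} b" by (simp add: l1_norm_on_def trunc_def)
    have "mat_vec p M (trunc b) = mat_vec p M b" by (simp add: mat_vec_def trunc_def fun_eq_iff)
    then show "feasible (trunc b) = feasible b" by (simp add: feasible_def)
  qed
  have in_T: "trunc b \<in> T" if "feasible b" "l1_norm_on {..<p} b \<le> B" for b
  proof -
    have "\<bar>b j\<bar> \<le> B" if "j < p" for j
    proof -
      have "\<bar>b j\<bar> \<le> l1_norm_on {..<p} b" unfolding l1_norm_on_def using that by (intro member_le_sum) auto
      with \<open>l1_norm_on {..<p} b \<le> B\<close> show ?thesis by linarith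
    qed
    then have "trunc b j \<in> (if j < p then {- B .. B} else {0})" for j
      by (auto simp: trunc_def abs_le_iff minus_le_iff)
    then show ?thesis using that trunc(2)[of b] by (auto simp: T_def)
  qed
  have coord: "continuous_on A (\<lambda>b :: nat \<Rightarrow> real. b j)" for A j
    by (rule continuous_on_subset[OF continuous_on_product_coordinates]) simp
  have "closed (Collect feasible)"
  proof -
    have "Collect feasible = (\<Inter>j\<in>{..<p}. {b. \<bar>mat_vec p M b j - g j\<bar> \<le> lam})"
      unfolding feasible_def linf_norm_le_iff[OF p] by auto
    moreover have "closed {b. \<bar>mat_vec p M b j - g j\<bar> \<le> lam}" for j
      unfolding mat_vec_def by (intro closed_Collect_le continuous_intros coord)
    ultimately show ?thesis by auto
  qed
  then have "compact T" unfolding T_def by (intro compact_Int_closed compact_box)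
  moreover have "trunc b0 \<in> T" using feas by (intro in_T) (auto simp: feasible_def B_def)
  then have "T \<noteq> {}" by blast
  moreover have "continuous_on T (l1_norm_on {..<p})"
    unfolding l1_norm_on_def by (intro continuous_intros coord)
  ultimately obtain b where b: "b \<in> T" "\<And>y. y \<in> T \<Longrightarrow> l1_norm_on {..<p} b \<le> l1_norm_on {..<p} y"
    using continuous_attains_inf[of T "l1_norm_on {..<p}"] by blast
  have "l1_norm_on {..<p} b \<le> B" using b(2)[OF \<open>trunc b0 \<in> T\<close>] trunc(1) by (simp add: B_def)
  have "l1_norm_on {..<p} b \<le> l1_norm_on {..<p} y" if "feasible y" for y
  proof (cases "l1_norm_on {..<p} y \<le> B")
    case True
    from b(2)[OF in_T[OF that True]] show ?thesis by (simp add: trunc(1))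
  qed (use \<open>l1_norm_on {..<p} b \<le> B\<close> in linarith)
  moreover have "feasible b" using b(1) by (simp add: T_def)
  ultimately have "is_arg_min (l1_norm_on {..<p}) feasible b"
    unfolding is_arg_min_def using linorder_not_less by blast
  then show ?thesis unfolding feasible_def by blast
qed

section \<open>The restricted eigenvalue argument\<close>

lemma kth_largest_abs_bounds:
  assumes T: "finite T" and k: "1 \<le> k" "k \<le> card T"
  shows "real k * kth_largest_abs T d k \<le> l1_norm_on T d"
    and "k = card T \<Longrightarrow> i \<in> T \<Longrightarrow> kth_largest_abs T d k \<le> \<bar>d i\<bar>"
proof -
  define ys where "ys = map (\<lambda>i. \<bar>d i\<bar>) (sorted_list_of_set T)"
  define xs where "xs = rev (sort ys)"
  have len: "length xs = card T" by (simp add: xs_def ys_def)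
  have kth: "kth_largest_abs T d k = xs ! (k - 1)" by (simp add: kth_largest_abs_def xs_def ys_def)
  have mono: "xs ! j \<le> xs ! i" if "i \<le> j" "j < length xs" for i j
    using that sorted_rev_nth_mono[of xs i j] by (simp add: xs_def)
  have set_xs: "set xs = (\<lambda>i. \<bar>d i\<bar>) ` T" using T by (simp add: xs_def ys_def)
  have "sum_list xs = sum_list ys" unfolding xs_def
    by (metis mset_rev mset_sort sum_mset_sum_list)
  also have "\<dots> = l1_norm_on T d"
    using T sum.distinct_set_conv_list[of "sorted_list_of_set T" "\<lambda>i. \<bar>d i\<bar>"]
    by (simp add: ys_def l1_norm_on_def)
  finally have sum_xs: "(\<Sum>j<card T. xs ! j) = l1_norm_on T d"
    by (simp add: sum_list_sum_nth len lessThan_atLeast0)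
  have "real k * xs ! (k - 1) = (\<Sum>j<k. xs ! (k - 1))" by simp
  also have "\<dots> \<le> (\<Sum>j<k. xs ! j)" using k len by (intro sum_mono mono) auto
  also have "\<dots> \<le> (\<Sum>j<card T. xs ! j)"
  proof (intro sum_mono2)
    fix j assume "j \<in> {..<card T} - {..<k}"
    then have "xs ! j \<in> set xs" using len by auto
    then show "0 \<le> xs ! j" unfolding set_xs by auto
  qed (use k in auto)
  finally show "real k * kth_largest_abs T d k \<le> l1_norm_on T d" by (simp add: kth sum_xs)
  assume kT: "k = card T" and i: "i \<in> T"
  then have "\<bar>d i\<bar> \<in> set xs" by (simp add: set_xs)
  then obtain j where "j < length xs" "xs ! j = \<bar>d i\<bar>" by (auto simp: in_set_conv_nth)
  with mono[of j "k - 1"] kT k len show "kth_largest_abs T d k \<le> \<bar>d i\<bar>" unfolding kth by simp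
qed

lemma l1_le_sqrt_card_L2:
  assumes "finite S" "card S \<le> s"
  shows "l1_norm_on S d \<le> sqrt (real s) * L2_set d S"
proof -
  have "l1_norm_on S d = (\<Sum>i\<in>S. \<bar>1::real\<bar> * \<bar>d i\<bar>)" by (simp add: l1_norm_on_def)
  also have "\<dots> \<le> L2_set (\<lambda>_. 1) S * L2_set d S" by (rule L2_set_mult_ineq)
  also have "\<dots> \<le> sqrt (real s) * L2_set d S"
    using assms by (intro mult_right_mono L2_set_nonneg) (simp add: L2_set_def)
  finally show ?thesis .
qed

lemma L2_set_sq: "(L2_set x S)\<^sup>2 = (\<Sum>i\<in>S. (x i)\<^sup>2)"
  by (simp add: L2_set_def sum_nonneg)

text \<open>
  An entry that is left out of \<open>re_support\<close> is smaller than the s-th largest entry off S, which is at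
  most \<open>1 / s\<close> times the \<open>\<ell>\<^sub>1\<close> norm off S. So the squares of the entries left out sum to at
  most \<open>1 / s\<close> times the square of that norm, and the cone condition and the Cauchy-Schwarz
  inequality bound this by the squared norm on S.
\<close>

lemma L2_set_cone_le:
  assumes S: "S \<subseteq> {..<p}" "card S \<le> s" and cone: "l1_norm_on ({..<p} - S) d \<le> l1_norm_on S d"
  shows "L2_set d S \<le> L2_set d (re_support p s S d)"
    and "(L2_set d {..<p})\<^sup>2 \<le> 2 * (L2_set d (re_support p s S d))\<^sup>2"
proof -
  define T where "T = {..<p} - S"
  define k where "k = min s (card T)"
  define \<kappa> where "\<kappa> = kth_largest_abs T d k"
  define M where "M = re_support p s S d"
  have M: "M = S \<union> {i \<in> T. \<kappa> \<le> \<bar>d i\<bar>}"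
    by (simp add: M_def re_support_def T_def \<kappa>_def k_def Let_def)
  have fin: "finite T" "finite S" "finite M" "M \<subseteq> {..<p}"
    using S finite_subset[of S "{..<p}"] unfolding M T_def by auto
  have SM: "(L2_set d S)\<^sup>2 \<le> (L2_set d M)\<^sup>2"
    unfolding L2_set_sq using fin M by (intro sum_mono2) auto
  then show "L2_set d S \<le> L2_set d (re_support p s S d)"
    unfolding M_def[symmetric] by (rule power2_le_imp_le) simp
    have l1_T: "l1_norm_on T d \<le> sqrt (real s) * L2_set d S"
      using cone l1_le_sqrt_card_L2[OF fin(2) S(2), of d] unfolding T_def by linarith
  have rest: "(\<Sum>i\<in>{..<p} - M. (d i)\<^sup>2) \<le> (L2_set d S)\<^sup>2"
  proof (cases "s = 0 \<or> {..<p} - M = {}")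
    case True
    have "d i = 0" if "s = 0" "i \<in> T" for i
    proof -
      have "(\<Sum>i\<in>T. \<bar>d i\<bar>) \<le> 0" using l1_T that(1) by (simp add: l1_norm_on_def)
      then have "(\<Sum>i\<in>T. \<bar>d i\<bar>) = 0" by (intro antisym sum_nonneg) auto
      then show ?thesis using fin(1) that(2) by (simp add: sum_nonneg_eq_0_iff)
    qed
    then have "(\<Sum>i\<in>{..<p} - M. (d i)\<^sup>2) = 0"
      using True by (intro sum.neutral) (auto simp: M T_def)
    then show ?thesis by simp
  next
    case False
    then have s1: "s \<ge> 1" by simp
    from False obtain i where i: "i \<in> T" "\<bar>d i\<bar> < \<kappa>" unfolding M T_def by force
    have cT: "card T \<ge> 1" using i(1) fin(1) by (simp add: Suc_le_eq card_gt_0_iff) blast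
    have k1: "1 \<le> k" "k \<le> card T" using s1 cT by (auto simp: k_def)
    \<comment> \<open>otherwise \<open>\<kappa>\<close> is the smallest entry off S, and no entry is left out\<close>
    have "k \<noteq> card T"
      using kth_largest_abs_bounds(2)[OF fin(1) k1 _ i(1), of d] i(2) unfolding \<kappa>_def by auto
    then have "k = s" by (auto simp: k_def)
    then have \<kappa>: "real s * \<kappa> \<le> l1_norm_on T d"
      using kth_largest_abs_bounds(1)[OF fin(1) k1, of d] by (simp add: \<kappa>_def)
    have \<kappa>0: "\<kappa> \<ge> 0" using i(2) by linarith
    have "(\<Sum>i\<in>{..<p} - M. (d i)\<^sup>2) \<le> (\<Sum>i\<in>{..<p} - M. \<kappa> * \<bar>d i\<bar>)"
    proof (intro sum_mono)
      fix i assume "i \<in> {..<p} - M"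
      then have "\<bar>d i\<bar> \<le> \<kappa>" unfolding M T_def by auto
      then have "\<bar>d i\<bar> * \<bar>d i\<bar> \<le> \<kappa> * \<bar>d i\<bar>" by (rule mult_right_mono) simp
      then show "(d i)\<^sup>2 \<le> \<kappa> * \<bar>d i\<bar>" by (simp add: power2_eq_square)
    qed
    also have "\<dots> \<le> (\<Sum>i\<in>T. \<kappa> * \<bar>d i\<bar>)"
      using fin(1) \<kappa>0 unfolding M T_def by (intro sum_mono2) auto
    also have "\<dots> = \<kappa> * l1_norm_on T d" by (simp add: l1_norm_on_def sum_distrib_left)
    finally have "real s * (\<Sum>i\<in>{..<p} - M. (d i)\<^sup>2) \<le> real s * (\<kappa> * l1_norm_on T d)"
      by (rule mult_left_mono) simp
    also have "\<dots> \<le> l1_norm_on T d * l1_norm_on T d"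
      unfolding mult.assoc[symmetric] using \<kappa> by (rule mult_right_mono) (simp add: l1_norm_on_def sum_nonneg)
    also have "\<dots> \<le> (sqrt (real s) * L2_set d S) * (sqrt (real s) * L2_set d S)"
      using l1_T by (intro mult_mono) (auto simp: l1_norm_on_def sum_nonneg)
    also have "\<dots> = real s * (L2_set d S)\<^sup>2" by (simp add: power2_eq_square)
    finally show ?thesis using s1 by simp
  qed
  have "(L2_set d {..<p})\<^sup>2 = (\<Sum>i\<in>{..<p} - M. (d i)\<^sup>2) + (L2_set d M)\<^sup>2"
    unfolding L2_set_sq using fin(4) by (intro sum.subset_diff) auto
  with rest SM show "(L2_set d {..<p})\<^sup>2 \<le> 2 * (L2_set d (re_support p s S d))\<^sup>2"
    unfolding M_def[symmetric] by linarith
qed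

lemma cone_of_l1_le:
  assumes le: "l1_norm_on {..<p} b \<le> l1_norm_on {..<p} \<beta>" and S: "S = {j. j < p \<and> \<beta> j \<noteq> 0}"
  shows "l1_norm_on ({..<p} - S) (\<lambda>j. b j - \<beta> j) \<le> l1_norm_on S (\<lambda>j. b j - \<beta> j)"
proof -
  have split: "l1_norm_on {..<p} x = l1_norm_on ({..<p} - S) x + l1_norm_on S x" for x
    unfolding l1_norm_on_def using S by (intro sum.subset_diff) auto
  have 1: "l1_norm_on ({..<p} - S) (\<lambda>j. b j - \<beta> j) = l1_norm_on ({..<p} - S) b"
    "l1_norm_on ({..<p} - S) \<beta> = 0"
    unfolding l1_norm_on_def using S by (auto intro!: sum.cong sum.neutral)
  have "l1_norm_on S \<beta> \<le> l1_norm_on S b + l1_norm_on S (\<lambda>j. b j - \<beta> j)"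
    unfolding l1_norm_on_def sum.distrib[symmetric] by (intro sum_mono) auto
  with le 1 show ?thesis unfolding split by linarith
qed

lemma inner_p_abs_le:
  assumes "\<And>j. j < p \<Longrightarrow> \<bar>y j\<bar> \<le> c"
  shows "\<bar>inner_p p x y\<bar> \<le> l1_norm_on {..<p} x * c"
proof -
  have "\<bar>inner_p p x y\<bar> \<le> (\<Sum>j<p. \<bar>x j\<bar> * \<bar>y j\<bar>)"
    unfolding inner_p_def by (rule order_trans[OF sum_abs]) (simp add: abs_mult)
  also have "\<dots> \<le> (\<Sum>j<p. \<bar>x j\<bar> * c)" using assms by (intro sum_mono mult_left_mono) auto
  finally show ?thesis by (simp add: l1_norm_on_def sum_distrib_right)
qed

text \<open>
  Let x be the norm of the error on \<open>re_support\<close>. Then \<open>\<Phi> x\<^sup>2\<close> is at most \<open>d\<^sup>T A d\<close>, which is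
  at most \<open>4 lam sqrt s x\<close> plus the price \<open>\<Phi> x\<^sup>2 / 2\<close> of passing from A to the matrix of the
  linear program. Hence x is at most \<open>8 lam sqrt s / \<Phi>\<close>, and the squared norm of the whole
  error is at most \<open>2 x\<^sup>2\<close>. The closeness hypothesis is multiplied by \<open>8 s\<close> so that it makes
  sense for \<open>s = 0\<close>, where the error vanishes.
\<close>

lemma oracle_inequality:
  assumes RE: "Re_cond p A s \<Phi>" "\<Phi> > 0" and \<beta>: "l0_norm p \<beta> \<le> s"
    and close: "\<And>i j. i < p \<Longrightarrow> j < p \<Longrightarrow> 8 * real s * \<bar>A' i j - A i j\<bar> \<le> \<Phi>"
    and feas: "\<And>j. j < p \<Longrightarrow> \<bar>mat_vec p A' \<beta> j - g j\<bar> \<le> lam" "\<And>j. j < p \<Longrightarrow> \<bar>mat_vec p A' b j - g j\<bar> \<le> lam"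
    and l1: "l1_norm_on {..<p} b \<le> l1_norm_on {..<p} \<beta>"
  shows "(L2_set (\<lambda>j. b j - \<beta> j) {..<p})\<^sup>2 \<le> 128 * (real s / \<Phi>\<^sup>2) * lam\<^sup>2"
proof (cases "\<exists>i<p. b i - \<beta> i \<noteq> 0")
  case False
  then have "(L2_set (\<lambda>j. b j - \<beta> j) {..<p})\<^sup>2 = 0" unfolding L2_set_sq by (intro sum.neutral) auto
  then show ?thesis by simp
next
  case True
  define d where "d j = b j - \<beta> j" for j
  define S where "S = {j. j < p \<and> \<beta> j \<noteq> 0}"
  have S: "S \<subseteq> {..<p}" "card S \<le> s" "finite S" using \<beta> by (auto simp: S_def l0_norm_def)
  have cone: "l1_norm_on ({..<p} - S) d \<le> l1_norm_on S d"
    unfolding d_def using l1 S_def by (rule cone_of_l1_le)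
  define x where "x = L2_set d (re_support p s S d)"
  have Sx: "L2_set d S \<le> x" and dx: "(L2_set d {..<p})\<^sup>2 \<le> 2 * x\<^sup>2"
    using L2_set_cone_le[OF S(1,2) cone] by (auto simp: x_def)
  have "ereal \<Phi> \<le> ereal (inner_p p d (mat_vec p A d) / x\<^sup>2)"
  proof -
    have "re_phi_sq p A s \<le> ereal (inner_p p d (mat_vec p A d) / x\<^sup>2)"
      unfolding re_phi_sq_def x_def using S True cone
      by (intro INF_lower2[of S] INF_lower2[of d]) (auto simp: d_def)
    with RE(1) show ?thesis unfolding Re_cond_def by (rule order_trans)
  qed
  then have q: "\<Phi> \<le> inner_p p d (mat_vec p A d) / x\<^sup>2" by simp
  \<comment> \<open>for \<open>x = 0\<close> the quotient would be 0 by the convention for division\<close>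
  have "x \<noteq> 0" using q RE(2) by auto
  then have x: "x > 0" using L2_set_nonneg[of d] by (simp add: x_def less_le)
  from q have q: "\<Phi> * x\<^sup>2 \<le> inner_p p d (mat_vec p A d)" using x by (simp add: pos_le_divide_eq)
  have lam: "lam \<ge> 0" using True feas(1) abs_ge_zero by (meson order_trans)
  have l1S: "l1_norm_on S d \<le> sqrt (real s) * x"
    using l1_le_sqrt_card_L2[OF S(3,2), of d] mult_left_mono[OF Sx, of "sqrt (real s)"] by simp
  have "l1_norm_on {..<p} d = l1_norm_on ({..<p} - S) d + l1_norm_on S d"
    unfolding l1_norm_on_def using S by (intro sum.subset_diff) auto
  then have l1d: "l1_norm_on {..<p} d \<le> 2 * (sqrt (real s) * x)" using cone l1S by linarith
  have l1d0: "l1_norm_on {..<p} d \<ge> 0" by (simp add: l1_norm_on_def sum_nonneg)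
  have "\<bar>inner_p p d (mat_vec p A' d)\<bar> \<le> l1_norm_on {..<p} d * (2 * lam)"
  proof (rule inner_p_abs_le)
    fix j assume j: "j < p"
    have "mat_vec p A' d j = (mat_vec p A' b j - g j) - (mat_vec p A' \<beta> j - g j)"
      by (simp add: mat_vec_def d_def right_diff_distrib sum_subtractf)
    then show "\<bar>mat_vec p A' d j\<bar> \<le> 2 * lam" using feas[OF j] by linarith
  qed
  also have "\<dots> \<le> 2 * (sqrt (real s) * x) * (2 * lam)" using l1d lam by (intro mult_right_mono) auto
  also have "\<dots> = 4 * lam * sqrt (real s) * x" by simp
  finally have 1: "\<bar>inner_p p d (mat_vec p A' d)\<bar> \<le> 4 * lam * sqrt (real s) * x" .
  have 2: "8 * real s * \<bar>inner_p p d (mat_vec p (\<lambda>i j. A' i j - A i j) d)\<bar> \<le> 4 * real s * x\<^sup>2 * \<Phi>"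
  proof -
    have "\<bar>mat_vec p (\<lambda>i j. 8 * real s * (A' i j - A i j)) d i\<bar> \<le> l1_norm_on {..<p} d * \<Phi>" if "i < p" for i
      using inner_p_abs_le[of p "\<lambda>j. 8 * real s * (A' i j - A i j)" \<Phi> d] close[OF that]
      by (simp add: mat_vec_def inner_p_def mult.commute abs_mult)
    then have "\<bar>inner_p p d (mat_vec p (\<lambda>i j. 8 * real s * (A' i j - A i j)) d)\<bar> \<le> l1_norm_on {..<p} d * (l1_norm_on {..<p} d * \<Phi>)"
      by (rule inner_p_abs_le)
    also have "inner_p p d (mat_vec p (\<lambda>i j. 8 * real s * (A' i j - A i j)) d)
        = 8 * real s * inner_p p d (mat_vec p (\<lambda>i j. A' i j - A i j) d)"
      by (simp only: inner_p_def mat_vec_def sum_distrib_left mult_ac)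
    also have "l1_norm_on {..<p} d * (l1_norm_on {..<p} d * \<Phi>) \<le> (2 * (sqrt (real s) * x)) * ((2 * (sqrt (real s) * x)) * \<Phi>)"
      using l1d l1d0 RE(2) x by (intro mult_mono) auto
    also have "\<dots> = 4 * real s * x\<^sup>2 * \<Phi>" by (simp add: power2_eq_square)
    finally show ?thesis by (simp add: abs_mult)
  qed
  have 3: "\<bar>inner_p p d (mat_vec p (\<lambda>i j. A' i j - A i j) d)\<bar> \<le> \<Phi> * x\<^sup>2 / 2"
  proof (cases "s = 0")
    case True
    then have "l1_norm_on {..<p} d = 0" using l1d l1d0 by simp
    then have "d i = 0" if "i < p" for i using that by (simp add: l1_norm_on_def sum_nonneg_eq_0_iff)
    with \<open>\<exists>i<p. b i - \<beta> i \<noteq> 0\<close> show ?thesis by (auto simp: d_def)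
  next
    case False
    with 2 show ?thesis by (simp add: field_simps)
  qed
  have "inner_p p d (mat_vec p A d) = inner_p p d (mat_vec p A' d) - inner_p p d (mat_vec p (\<lambda>i j. A' i j - A i j) d)"
    by (simp add: inner_p_def mat_vec_def sum_subtractf algebra_simps)
  with q 1 3 have "\<Phi> * x\<^sup>2 / 2 \<le> 4 * lam * sqrt (real s) * x" by linarith
  then have "(\<Phi> * x) * x \<le> (8 * lam * sqrt (real s)) * x" by (simp add: power2_eq_square)
  then have "\<Phi> * x \<le> 8 * lam * sqrt (real s)" using x by simp
  then have "(\<Phi> * x)\<^sup>2 \<le> (8 * lam * sqrt (real s))\<^sup>2" using RE(2) x by (intro power_mono) auto
  then have "\<Phi>\<^sup>2 * x\<^sup>2 \<le> 64 * real s * lam\<^sup>2" by (simp add: power_mult_distrib mult_ac)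
  then have "x\<^sup>2 \<le> 64 * (real s / \<Phi>\<^sup>2) * lam\<^sup>2" using RE(2) by (simp add: field_simps)
  with dx show ?thesis unfolding d_def by linarith
qed

section \<open>The error bound\<close>

lemma measure_UNION_le_card:
  assumes "finite I" "\<And>i. i \<in> I \<Longrightarrow> B i \<in> sets M" "\<And>i. i \<in> I \<Longrightarrow> measure M (B i) \<le> q" "real (card I) * q \<le> r"
  shows "(\<Union>i\<in>I. B i) \<in> sets M" "measure M (\<Union>i\<in>I. B i) \<le> r"
proof -
  show "(\<Union>i\<in>I. B i) \<in> sets M" using assms(1,2) by auto
  have "measure M (\<Union>i\<in>I. B i) \<le> (\<Sum>i\<in>I. measure M (B i))"
    using assms(1,2) by (rule measure_UNION_le)
  also have "\<dots> \<le> (\<Sum>i\<in>I. q)" using assms(3) by (rule sum_mono)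
  finally show "measure M (\<Union>i\<in>I. B i) \<le> r" using assms(4) by simp
qed

lemma (in prob_space) with_prob_at_least_of_bad_events:
  assumes "B1 \<in> events" "B2 \<in> events" "B3 \<in> events"
    and "prob B1 \<le> r" "prob B2 \<le> r" "prob B3 \<le> r"
    and Q: "\<And>w. w \<in> space M \<Longrightarrow> w \<notin> B1 \<Longrightarrow> w \<notin> B2 \<Longrightarrow> w \<notin> B3 \<Longrightarrow> Q w"
  shows "with_prob_at_least M (1 - 3 * r) Q"
  unfolding with_prob_at_least_def
proof (intro bexI conjI ballI)
  let ?B = "B1 \<union> (B2 \<union> B3)"
  have "prob ?B \<le> prob B1 + prob (B2 \<union> B3)" using assms by (intro measure_Un_le) auto
  also have "prob (B2 \<union> B3) \<le> prob B2 + prob B3" using assms by (intro measure_Un_le) auto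
  finally have "prob ?B \<le> 3 * r" using assms(4-6) by linarith
  then show "1 - 3 * r \<le> prob (space M - ?B)" using assms by (subst prob_compl) auto
  show "space M - ?B \<in> events" using assms by auto
  show "Q w" if "w \<in> space M - ?B" for w using that by (intro Q) auto
qed

text \<open>
  The square roots of the two terms in the maximum that defines lam are the scales of the
  deviations of \<open>gamma_hat\<close> and of \<open>Sigma_hat\<close> applied to \<open>\<beta>\<close>. The factor \<open>A / 2 \<ge> 250\<close> exceeds both thresholds 228 and 76. The
  entrywise deviation uses the factor 125 in place of \<open>A / 2\<close>. The last hypothesis gives
  \<open>sqrt (ln p / m) \<le> \<Phi> / (1000 R\<^sup>2 s)\<close>, and \<open>125 / 1000\<close> is the \<open>1 / 8\<close> that the oracle
  inequality asks for.
\<close>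

lemma (in sub_gaussian_regression) estimation_error:
  assumes p: "p \<ge> 2"
    and Ob: "\<forall>k<K. Ob k \<subseteq> {..<p}" and \<L>: "modalities p K Ob \<L>" and K: "(\<Union>k<K. Ob k) = {..<p}"
    and RE: "\<Phi> > 0" "Re_cond p (Sigma_X P) s \<Phi>" and l0: "l0_norm p \<beta> \<le> s"
    and h0: "\<forall>G\<in>\<L>. h\<^sub>0 \<le> real (h_count K Ob n G)"
    and m: "\<forall>G\<in>\<L>. \<forall>H\<in>\<L>. m \<le> real (pair_count K Ob n G H) + real N"
    and A: "A \<ge> 500"
    and lam: "lam = A * sqrt (max (R\<^sup>2 * scale_Y\<^sup>2 * ln p / h\<^sub>0) (R ^ 4 * (L2_set \<beta> {..<p})\<^sup>2 * ln p / m))"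
    and est: "is_estimator p K Ob n N \<L> lam \<beta>hat"
    and h0_large: "10 ^ 6 * A\<^sup>2 * ln p \<le> h\<^sub>0"
    and m_large: "10 ^ 6 * A\<^sup>2 * ln p \<le> m" "10 ^ 6 * (R ^ 4 * (real s)\<^sup>2 / \<Phi>\<^sup>2) * ln p \<le> m"
  shows "with_prob_at_least (data_law p K Ob n N P) (1 - 6 / real p)
        (\<lambda>D. (L2_set (\<lambda>j. \<beta>hat D j - \<beta> j) {..<p})\<^sup>2 \<le>
          128 * (A\<^sup>2 * real s / \<Phi>\<^sup>2) * (R\<^sup>2 * scale_Y\<^sup>2 * ln p / h\<^sub>0 + R ^ 4 * (L2_set \<beta> {..<p})\<^sup>2 * ln p / m))"
proof -
  define L where "L = ln (real p)"
  have L: "L > 0" using p by (simp add: L_def)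
  let ?D = "data_law p K Ob n N P"
  have D: "prob_space ?D" using data_law_parts(5)[OF prob_space_axioms sets_P Ob] .
  have "1 * 1 \<le> A * A" using A by (intro mult_mono) auto
  then have "4 * 1 \<le> 10 ^ 6 * A\<^sup>2" by (simp add: power2_eq_square)
  then have "4 * L \<le> 10 ^ 6 * A\<^sup>2 * L" using L by (intro mult_right_mono) auto
  then have large: "4 * L \<le> h\<^sub>0" "4 * L \<le> m" using h0_large m_large(1) unfolding L_def[symmetric] by linarith+
  then have pos: "h\<^sub>0 > 0" "m > 0" using L by auto
  have in_L: "modality_of \<L> j \<in> \<L>" if "j < p" for j
  proof -
    obtain k where "k < K" using K \<open>j < p\<close> by blast
    then show ?thesis by (rule modality_of_subset_iff(1)[OF \<L> \<open>j < p\<close>])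
  qed
  have hc: "h\<^sub>0 \<le> real (h_count K Ob n (modality_of \<L> j))" if "j < p" for j using h0 in_L[OF that] by blast
  have pc: "m \<le> real (pair_count K Ob n (modality_of \<L> j) (modality_of \<L> l)) + real N" if "j < p" "l < p" for j l
    using m in_L that by blast
  define S where "S = Sigma_X P"
  define Sh where "Sh D = Sigma_hat K Ob n N \<L> D" for D
  define gh where "gh D = gamma_hat K Ob n \<L> D" for D
  define t1 where "t1 = A / 2 * (R * scale_Y) * sqrt (L / h\<^sub>0)"
  define t2 where "t2 = A / 2 * (R\<^sup>2 * L2_set \<beta> {..<p}) * sqrt (L / m)"
  define t3 where "t3 = 125 * R\<^sup>2 * sqrt (L / m)"
  define bad_gamma where "bad_gamma j = {D \<in> space ?D. \<bar>gh D j - mat_vec p S \<beta> j\<bar> > t1}" for j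
  define bad_Sigma where "bad_Sigma v t j = {D \<in> space ?D. \<bar>mat_vec p (Sh D) v j - mat_vec p S v j\<bar> > t}" for v t j
  define e :: "nat \<Rightarrow> nat \<Rightarrow> real" where "e l = (\<lambda>k. of_bool (k = l))" for l
  \<comment> \<open>the cube pays for a union over all pairs of coordinates\<close>
  define q where "q = 2 / real p ^ 3"
  have q: "2 * exp (- 3 * L) = q"
    using p by (simp add: q_def L_def exp_minus exp_of_nat_mult[of 3, simplified] divide_inverse)
  have sets_gamma: "bad_gamma j \<in> sets ?D" if j: "j < p" for j
  proof -
    have "real (h_count K Ob n (modality_of \<L> j)) > 0" using hc[OF j] pos by linarith
    then have [measurable]: "(\<lambda>D. gh D j) \<in> borel_measurable ?D"
      using gamma_hat_sub_exponential[OF Ob \<L> j refl] unfolding gh_def by (simp add: sub_exponential_def)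
    show ?thesis unfolding bad_gamma_def by measurable
  qed
  have sets_Sigma: "bad_Sigma v t j \<in> sets ?D" if j: "j < p" for v t j
  proof -
    have [measurable]: "(\<lambda>D. mat_vec p (Sh D) v j) \<in> borel_measurable ?D"
      using Sigma_hat_sub_exponential[OF Ob \<L> j pos(2) pc[OF j]] unfolding Sh_def by (simp add: sub_exponential_def)
    show ?thesis unfolding bad_Sigma_def by measurable
  qed
  have tail_gamma: "measure ?D (bad_gamma j) \<le> q" if j: "j < p" for j
    using gamma_hat_tail[OF Ob \<L> j hc[OF j] pos(1), of L "A / 2" N] A L large q
    unfolding bad_gamma_def t1_def gh_def S_def by simp
  have tail_Sigma: "measure ?D (bad_Sigma v (T * (R\<^sup>2 * L2_set v {..<p}) * sqrt (L / m)) j) \<le> q"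
    if j: "j < p" and T: "T \<ge> 76" for v T j
    using Sigma_hat_tail[OF Ob \<L> j pos(2) pc[OF j], where L = L and T = T and v = v] T L large q
    unfolding bad_Sigma_def Sh_def S_def by simp
  have tail_entry: "measure ?D (bad_Sigma (e l) t3 j) \<le> q" if "j < p" "l < p" for j l
    using tail_Sigma[of j 125 "e l"] that by (simp add: t3_def e_def L2_set_unit)
  have pq: "real (card {..<p}) * q \<le> 2 / real p" "real (card ({..<p} \<times> {..<p})) * q \<le> 2 / real p"
  proof -
    have "real p * q = 2 / real p ^ 2" "real (p * p) * q = 2 / real p"
      using p by (simp_all add: q_def power2_eq_square power3_eq_cube)
    moreover have "2 / real p ^ 2 \<le> 2 / real p"
      using p by (intro divide_left_mono) (auto simp: power2_eq_square)
    ultimately show "real (card {..<p}) * q \<le> 2 / real p" "real (card ({..<p} \<times> {..<p})) * q \<le> 2 / real p"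
      by (simp_all add: card_cartesian_product)
  qed
  note U1 = measure_UNION_le_card[of "{..<p}" bad_gamma ?D, OF _ sets_gamma tail_gamma pq(1)]
  note U2 = measure_UNION_le_card[of "{..<p}" "bad_Sigma \<beta> t2" ?D, OF _ sets_Sigma tail_Sigma[of _ "A / 2" \<beta>, folded t2_def] pq(1)]
  note U3 = measure_UNION_le_card[of "{..<p} \<times> {..<p}" "\<lambda>(j, l). bad_Sigma (e l) t3 j" ?D q, OF _ _ _ pq(2)]
  have "with_prob_at_least ?D (1 - 3 * (2 / real p))
     (\<lambda>D. (L2_set (\<lambda>j. \<beta>hat D j - \<beta> j) {..<p})\<^sup>2 \<le>
          128 * (A\<^sup>2 * real s / \<Phi>\<^sup>2) * (R\<^sup>2 * scale_Y\<^sup>2 * ln p / h\<^sub>0 + R ^ 4 * (L2_set \<beta> {..<p})\<^sup>2 * ln p / m))"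
  proof (rule prob_space.with_prob_at_least_of_bad_events[OF D])
    show "(\<Union>j\<in>{..<p}. bad_gamma j) \<in> sets ?D" "measure ?D (\<Union>j\<in>{..<p}. bad_gamma j) \<le> 2 / real p"
      using U1 by auto
    show "(\<Union>j\<in>{..<p}. bad_Sigma \<beta> t2 j) \<in> sets ?D" "measure ?D (\<Union>j\<in>{..<p}. bad_Sigma \<beta> t2 j) \<le> 2 / real p"
      using U2 A by auto
    show "(\<Union>(j, l)\<in>{..<p} \<times> {..<p}. bad_Sigma (e l) t3 j) \<in> sets ?D"
      "measure ?D (\<Union>(j, l)\<in>{..<p} \<times> {..<p}. bad_Sigma (e l) t3 j) \<le> 2 / real p"
      using U3 sets_Sigma tail_entry by auto
    fix D assume "D \<in> space ?D" "D \<notin> (\<Union>j\<in>{..<p}. bad_gamma j)" "D \<notin> (\<Union>j\<in>{..<p}. bad_Sigma \<beta> t2 j)"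
      "D \<notin> (\<Union>(j, l)\<in>{..<p} \<times> {..<p}. bad_Sigma (e l) t3 j)"
    then have good: "\<bar>gh D j - mat_vec p S \<beta> j\<bar> \<le> t1" "\<bar>mat_vec p (Sh D) \<beta> j - mat_vec p S \<beta> j\<bar> \<le> t2"
      "\<bar>mat_vec p (Sh D) (e l) j - mat_vec p S (e l) j\<bar> \<le> t3" if "j < p" "l < p" for j l
      using that by (auto simp: bad_gamma_def bad_Sigma_def not_less)
    define r where "r = max (R\<^sup>2 * scale_Y\<^sup>2 * L / h\<^sub>0) (R ^ 4 * (L2_set \<beta> {..<p})\<^sup>2 * L / m)"
    have lam_r: "lam = A * sqrt r" unfolding lam r_def L_def ..
    have "(R * scale_Y) * sqrt (L / h\<^sub>0) = sqrt (R\<^sup>2 * scale_Y\<^sup>2 * L / h\<^sub>0)"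
      using R_pos scale_Y_nonneg by (simp add: real_sqrt_mult real_sqrt_divide)
    also have "\<dots> \<le> sqrt r" by (simp add: r_def)
    finally have "A / 2 * ((R * scale_Y) * sqrt (L / h\<^sub>0)) \<le> A / 2 * sqrt r" using A by (intro mult_left_mono) auto
    then have t1: "t1 \<le> lam / 2" by (simp add: t1_def lam_r mult.assoc)
    have "sqrt (R ^ 4) = R\<^sup>2" by (rule real_sqrt_unique) simp_all
    then have "(R\<^sup>2 * L2_set \<beta> {..<p}) * sqrt (L / m) = sqrt (R ^ 4 * (L2_set \<beta> {..<p})\<^sup>2 * L / m)"
      by (simp add: real_sqrt_mult real_sqrt_divide)
    also have "\<dots> \<le> sqrt r" by (simp add: r_def)
    finally have "A / 2 * ((R\<^sup>2 * L2_set \<beta> {..<p}) * sqrt (L / m)) \<le> A / 2 * sqrt r" using A by (intro mult_left_mono) auto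
    then have t2: "t2 \<le> lam / 2" by (simp add: t2_def lam_r mult.assoc)
    have feas: "\<bar>mat_vec p (Sh D) \<beta> j - gh D j\<bar> \<le> lam" if "j < p" for j
      using good(1,2)[OF that that] t1 t2 by linarith
    have "\<exists>b. is_estimate p K Ob n N \<L> lam D b"
      unfolding is_estimate_def using p feas
      by (intro l1_minimizer_exists[of p _ \<beta>]) (auto simp: linf_norm_le_iff Sh_def gh_def)
    then have "is_estimate p K Ob n N \<L> lam D (\<beta>hat D)" using est unfolding is_estimator_def by blast
    then have feas': "linf_norm p (\<lambda>j. mat_vec p (Sh D) (\<beta>hat D) j - gh D j) \<le> lam"
      and min: "\<not> l1_norm_on {..<p} \<beta> < l1_norm_on {..<p} (\<beta>hat D)"
      using p feas unfolding is_estimate_def is_arg_min_def Sh_def gh_def by (auto simp: linf_norm_le_iff)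
    have "(1000 * R\<^sup>2 * real s * sqrt (L / m))\<^sup>2 = 10 ^ 6 * (R ^ 4 * (real s)\<^sup>2) * L / m"
      using L pos by (simp add: power_mult_distrib)
    also have "\<dots> \<le> \<Phi>\<^sup>2"
      using m_large(2) RE(1) pos(2) by (simp add: L_def field_simps)
    finally have "1000 * R\<^sup>2 * real s * sqrt (L / m) \<le> \<Phi>" by (rule power2_le_imp_le) (use RE(1) in simp)
    then have t3: "8 * real s * t3 \<le> \<Phi>" by (simp add: t3_def mult_ac)
    have close: "8 * real s * \<bar>Sh D j l - S j l\<bar> \<le> \<Phi>" if "j < p" "l < p" for j l
    proof -
      have "\<bar>Sh D j l - S j l\<bar> \<le> t3" using good(3)[OF that] that by (simp add: mat_vec_def e_def)
      then have "8 * real s * \<bar>Sh D j l - S j l\<bar> \<le> 8 * real s * t3" by (intro mult_left_mono) auto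
      with t3 show ?thesis by linarith
    qed
    have "(L2_set (\<lambda>j. \<beta>hat D j - \<beta> j) {..<p})\<^sup>2 \<le> 128 * (real s / \<Phi>\<^sup>2) * lam\<^sup>2"
      using RE(2,1) l0 close feas feas' min p unfolding S_def
      by (intro oracle_inequality[where A' = "Sh D" and g = "gh D"]) (auto simp: linf_norm_le_iff)
    also have "lam\<^sup>2 = A\<^sup>2 * r"
      using R_pos scale_Y_nonneg L pos by (simp add: lam_r power_mult_distrib r_def le_max_iff_disj)
    also have "128 * (real s / \<Phi>\<^sup>2) * (A\<^sup>2 * r) = 128 * (A\<^sup>2 * real s / \<Phi>\<^sup>2) * r" by simp
    also have "\<dots> \<le> 128 * (A\<^sup>2 * real s / \<Phi>\<^sup>2) * (R\<^sup>2 * scale_Y\<^sup>2 * L / h\<^sub>0 + R ^ 4 * (L2_set \<beta> {..<p})\<^sup>2 * L / m)"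
      using L pos by (intro mult_left_mono) (auto simp: r_def)
    finally show "(L2_set (\<lambda>j. \<beta>hat D j - \<beta> j) {..<p})\<^sup>2 \<le>
          128 * (A\<^sup>2 * real s / \<Phi>\<^sup>2) * (R\<^sup>2 * scale_Y\<^sup>2 * ln p / h\<^sub>0 + R ^ 4 * (L2_set \<beta> {..<p})\<^sup>2 * ln p / m)"
      unfolding L_def .
  qed
  then show ?thesis by simp
qed

theorem theorem6:
  shows "\<exists>F A0 C :: real. F > 0 \<and> A0 > 0 \<and> C > 0 \<and>
    (\<forall>(p::nat) (K::nat) (Ob :: nat \<Rightarrow> nat set) (n :: nat \<Rightarrow> nat) (N::nat) (\<L> :: nat set set)
      (P :: ((nat \<Rightarrow> real) \<times> real) measure) (\<beta> :: nat \<Rightarrow> real) (\<sigma>::real)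
      (R\<^sub>X::real) (s::nat) (\<Phi>::real) (\<rho>::real) (A::real) (lam::real)
      (\<beta>hat :: data \<Rightarrow> nat \<Rightarrow> real).
      p \<ge> 1 \<longrightarrow>
      (\<forall>k<K. Ob k \<subseteq> {..<p}) \<longrightarrow> (\<Union>k<K. Ob k) = {..<p} \<longrightarrow>
      modalities p K Ob \<L> \<longrightarrow>
      linear_model p P \<beta> \<sigma> \<longrightarrow>
      (\<forall>G\<in>\<L>. \<forall>H\<in>\<L>. pair_count K Ob n G H + N > 0) \<longrightarrow>
      (\<forall>j<p. mean_X P j = 0) \<longrightarrow>
      R\<^sub>X > 0 \<longrightarrow> psi2_norm_vec p P fst \<le> ennreal R\<^sub>X \<longrightarrow>
      sub_gaussian P (noise p \<beta>) \<sigma> \<longrightarrow>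
      s \<le> p \<longrightarrow> \<Phi> > 0 \<longrightarrow> Re_cond p (Sigma_X P) s \<Phi> \<longrightarrow>
      l0_norm p \<beta> \<le> s \<longrightarrow>
      0 < \<rho> \<longrightarrow> \<rho> < 1 \<longrightarrow>
      (\<forall>G\<in>\<L>. \<forall>H\<in>\<L>. \<rho> * real (n_lab K n) \<le> real (h_count K Ob n G) \<and>
         \<rho>\<^sup>2 * real (n_lab K n) \<le> real (pair_count K Ob n G H)) \<longrightarrow>
      A > 0 \<longrightarrow>
      lam = A * sqrt (max
        (R\<^sub>X\<^sup>2 * (\<sigma> + R\<^sub>X * L2_set \<beta> {..<p})\<^sup>2 * ln (real p) / (\<rho> * real (n_lab K n)))
        (R\<^sub>X ^ 4 * (L2_set \<beta> {..<p})\<^sup>2 * ln (real p) / (\<rho>\<^sup>2 * real (n_lab K n) + real N))) \<longrightarrow>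
      is_estimator p K Ob n N \<L> lam \<beta>hat \<longrightarrow>
      \<rho> * real (n_lab K n) \<ge>
        F * A\<^sup>2 * max 1 ((\<sigma> + R\<^sub>X * L2_set \<beta> {..<p})\<^sup>2 / (R\<^sub>X\<^sup>2 * (L2_set \<beta> {..<p})\<^sup>2)) * ln (real p) \<longrightarrow>
      \<rho>\<^sup>2 * real (n_lab K n) + real N \<ge>
        F * Max {R\<^sub>X ^ 4 * (real s)\<^sup>2 / \<Phi>\<^sup>2, R\<^sub>X\<^sup>2 * real s / \<Phi>, A\<^sup>2,
                 A\<^sup>2 * R\<^sub>X\<^sup>2 * (L2_set \<beta> {..<p})\<^sup>2 / (\<sigma> + R\<^sub>X * L2_set \<beta> {..<p})\<^sup>2} * ln (real p) \<longrightarrow>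
      A \<ge> A0 \<longrightarrow>
      with_prob_at_least (data_law p K Ob n N P) (1 - 6 / real p)
        (\<lambda>D. (L2_set (\<lambda>j. \<beta>hat D j - \<beta> j) {..<p})\<^sup>2 \<le>
          C * (A\<^sup>2 * real s / \<Phi>\<^sup>2) *
          (R\<^sub>X\<^sup>2 * (\<sigma> + R\<^sub>X * L2_set \<beta> {..<p})\<^sup>2 * ln (real p) / (\<rho> * real (n_lab K n)) +
           R\<^sub>X ^ 4 * (L2_set \<beta> {..<p})\<^sup>2 * ln (real p) / (\<rho>\<^sup>2 * real (n_lab K n) + real N))))"
proof (rule exI[of _ "10 ^ 6"], rule exI[of _ 500], rule exI[of _ 128], intro conjI allI impI)
  fix p K :: nat and Ob :: "nat \<Rightarrow> nat set" and n :: "nat \<Rightarrow> nat" and N :: nat and \<L> :: "nat set set"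
    and P :: "((nat \<Rightarrow> real) \<times> real) measure" and \<beta> :: "nat \<Rightarrow> real" and \<sigma> R :: real and s :: nat
    and \<Phi> \<rho> A lam :: real and \<beta>hat :: "data \<Rightarrow> nat \<Rightarrow> real"
  let ?V = "\<sigma> + R * L2_set \<beta> {..<p}" and ?n = "real (n_lab K n)"
  let ?h = "\<rho> * ?n" and ?m = "\<rho>\<^sup>2 * ?n + real N"
  assume p: "1 \<le> p" and Ob: "\<forall>k<K. Ob k \<subseteq> {..<p}" "(\<Union>k<K. Ob k) = {..<p}" and \<L>: "modalities p K Ob \<L>"
    and model: "linear_model p P \<beta> \<sigma>" and R: "R > 0" and psi2: "psi2_norm_vec p P fst \<le> ennreal R"
    and sg: "sub_gaussian P (noise p \<beta>) \<sigma>" and \<Phi>: "\<Phi> > 0" "Re_cond p (Sigma_X P) s \<Phi>" and l0: "l0_norm p \<beta> \<le> s"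
    and \<rho>: "0 < \<rho>"
    and counts: "\<forall>G\<in>\<L>. \<forall>H\<in>\<L>. ?h \<le> real (h_count K Ob n G) \<and> \<rho>\<^sup>2 * ?n \<le> real (pair_count K Ob n G H)"
    and lam: "lam = A * sqrt (max (R\<^sup>2 * ?V\<^sup>2 * ln (real p) / ?h) (R ^ 4 * (L2_set \<beta> {..<p})\<^sup>2 * ln (real p) / ?m))"
    and est: "is_estimator p K Ob n N \<L> lam \<beta>hat"
    and h_large: "10 ^ 6 * A\<^sup>2 * max 1 (?V\<^sup>2 / (R\<^sup>2 * (L2_set \<beta> {..<p})\<^sup>2)) * ln (real p) \<le> ?h"
    and m_large: "10 ^ 6 * Max {R ^ 4 * (real s)\<^sup>2 / \<Phi>\<^sup>2, R\<^sup>2 * real s / \<Phi>, A\<^sup>2,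
                 A\<^sup>2 * R\<^sup>2 * (L2_set \<beta> {..<p})\<^sup>2 / ?V\<^sup>2} * ln (real p) \<le> ?m" (is "10 ^ 6 * Max ?X * _ \<le> _")
    and A: "500 \<le> A"
  let ?Q = "\<lambda>D. (L2_set (\<lambda>j. \<beta>hat D j - \<beta> j) {..<p})\<^sup>2 \<le> 128 * (A\<^sup>2 * real s / \<Phi>\<^sup>2) *
          (R\<^sup>2 * ?V\<^sup>2 * ln (real p) / ?h + R ^ 4 * (L2_set \<beta> {..<p})\<^sup>2 * ln (real p) / ?m)"
  show "with_prob_at_least (data_law p K Ob n N P) (1 - 6 / real p) ?Q"
  proof (cases "p = 1")
    case True
    \<comment> \<open>the claimed probability is negative, so the empty event will do\<close>
    then show ?thesis unfolding with_prob_at_least_def by (intro bexI[of _ "{}"]) auto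
  next
    case False
    with p have p2: "p \<ge> 2" by simp
    interpret sub_gaussian_regression p P \<beta> \<sigma> R
      by (rule sub_gaussian_regression.intro[OF model R psi2 sg])
    have L: "ln (real p) \<ge> 0" using p by simp
    have "10 ^ 6 * A\<^sup>2 * 1 * ln (real p) \<le> 10 ^ 6 * A\<^sup>2 * max 1 (?V\<^sup>2 / (R\<^sup>2 * (L2_set \<beta> {..<p})\<^sup>2)) * ln (real p)"
      using L by (intro mult_right_mono mult_left_mono) auto
    with h_large have h: "10 ^ 6 * A\<^sup>2 * ln (real p) \<le> ?h" by linarith
    have m: "10 ^ 6 * x * ln (real p) \<le> ?m" if "x \<in> ?X" for x
    proof -
      have "10 ^ 6 * x * ln (real p) \<le> 10 ^ 6 * Max ?X * ln (real p)"
        using L that by (intro mult_right_mono mult_left_mono Max_ge) auto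
      with m_large show ?thesis by linarith
    qed
    have "\<forall>G\<in>\<L>. ?h \<le> real (h_count K Ob n G)" using counts by blast
    moreover have "\<forall>G\<in>\<L>. \<forall>H\<in>\<L>. ?m \<le> real (pair_count K Ob n G H) + real N" using counts by auto
    ultimately show ?thesis
      using estimation_error[OF p2 Ob(1) \<L> Ob(2) \<Phi> l0 _ _ A lam[folded scale_Y_def] est h m m]
      unfolding scale_Y_def by simp
  qed
qed auto

end
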